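(* Let $\mathcal I\subset\mathbb C[\underline z]$ be a homogeneous ideal and let $\{p_1,\ldots,p_v\}$ be a minimal set of generators for $\mathcal I$ consisting of homogeneous polynomials (not necessarily of the same degree). Let $K$ be the reproducing kernel of the Hilbert module $[\mathcal I]$, which is assumed to be in $\mathfrak B_1(\Omega^* )$, where $0\in\Omega$. Then there exists a set of generators $q_1,\ldots,q_v$ for the ideal $\mathcal I$ such that the set $$\{q_i(\bar D)K(\cdot,w)|_{w=0}:\ 1\le i\le v\}$$ is a basis for $\bigcap_{j=1}^m\ker M_j^*$.
   Context: $\Omega\subset\mathbb C^m$ is a bounded domain, $\Omega^*=\{\bar z:z\in\Omega\}$, and $\mathbb C[\underline z]=\mathbb C[z_1,\ldots,z_m]$. Hilbert modules here are Hilbert spaces $\mathcal M$ of holomorphic functions on $\Omega$ on which multiplication $M_j$ by each coordinate function $z_j$ is a bounded operator; $M_j^*$ is its adjoint on $\mathcal M$. $\mathfrak m_w$ is the maximal ideal of $\mathbb C[\underline z]$ at $w$. $\mathcal M$ is in the class $\mathfrak B_1(\Omega^* )$ if it possesses a reproducing kernel $K$ (it is allowed that $K(w,w)=0$ on some closed subset of $\Omega$) and $\dim\mathcal M/\mathfrak m_w\mathcal M<\infty$ for all $w\in\Omega$. $[\mathcal I]$ denotes a Hilbert module containing $\mathcal I$ as a dense subspace (the completion of $\mathcal I$ with respect to some inner product). A set of generators is minimal if no proper subset generates. For $q=\sum_\alpha a_\alpha z^\alpha$, $q(\bar D)=\sum_\alpha a_\alpha\bar\partial^\alpha$, where $\bar\partial^\alpha=\partial^{|\alpha|}/\partial\bar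 w_1^{\alpha_1}\cdots\partial\bar w_m^{\alpha_m}$ acts on the variable $\bar w$ of $K(\cdot,w)$. *)

theory Defs
  imports
    "HOL-Analysis.Analysis"
    "HOL-Library.Poly_Mapping"
    "HOL-Library.Function_Algebras"
begin

section \<open>Polynomials and ideals\<close>

text \<open>
  The index type \<open>'n\<close> has \<open>m = CARD('n)\<close> elements; a multi-index is a finitely supported
  function on it.
\<close>

type_synonym 'n cpoly = "('n \<Rightarrow>\<^sub>0 nat) \<Rightarrow>\<^sub>0 complex"

definition poly_eval :: "'n::finite cpoly \<Rightarrow> complex ^ 'n \<Rightarrow> complex" where
  "poly_eval p z =
    (\<Sum>\<alpha>\<in>Poly_Mapping.keys p.
      Poly_Mapping.lookup p \<alpha> * (\<Prod>i\<in>UNIV. z $ i ^ Poly_Mapping.lookup \<alpha> i))"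

text \<open>
  A commutative ring as a module over itself: \<open>ideal.subspace\<close> says that a set is an ideal and
  \<open>ideal.span G\<close> is the ideal generated by \<open>G\<close>.
\<close>

interpretation ideal: module "(*) :: 'a::comm_ring_1 \<Rightarrow> 'a \<Rightarrow> 'a"
  by (rule module.intro) (rule distrib_left distrib_right mult.assoc [symmetric] mult_1_left)+

(* as a simp rule, reassociation of products loops with algebra_simps *)
declare ideal.scale_scale [simp del]

definition multi_degree :: "('n::finite \<Rightarrow>\<^sub>0 nat) \<Rightarrow> nat" where
  "multi_degree \<alpha> = (\<Sum>i\<in>UNIV. Poly_Mapping.lookup \<alpha> i)"

definition homogeneous_poly :: "'n::finite cpoly \<Rightarrow> bool" where
  "homogeneous_poly p \<longleftrightarrow> (\<exists>d. \<forall>\<alpha>\<in>Poly_Mapping.keys p. multi_degree \<alpha> = d)"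

definition homogeneous_ideal :: "'n::finite cpoly set \<Rightarrow> bool" where
  "homogeneous_ideal I \<longleftrightarrow>
    ideal.subspace I \<and> (\<exists>G. (\<forall>g\<in>G. homogeneous_poly g) \<and> ideal.span G = I)"

definition minimal_generators :: "'n::finite cpoly set \<Rightarrow> 'n cpoly set \<Rightarrow> bool" where
  "minimal_generators I G \<longleftrightarrow> ideal.span G = I \<and> (\<forall>G'. G' \<subset> G \<longrightarrow> ideal.span G' \<noteq> I)"

definition maximal_ideal_at :: "complex ^ 'n::finite \<Rightarrow> 'n cpoly set" where
  "maximal_ideal_at w = {p. poly_eval p w = 0}"


section \<open>Holomorphic functions of several variables\<close>

text \<open>
  A function on \<open>\<Omega>\<close> is represented by the total function that vanishes outside \<open>\<Omega>\<close>.
\<close>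

definition fun_scale :: "complex \<Rightarrow> ('a \<Rightarrow> complex) \<Rightarrow> 'a \<Rightarrow> complex" where
  "fun_scale c f = (\<lambda>z. c * f z)"

interpretation cfun: vector_space fun_scale
  by (rule vector_space.intro)
    (simp_all only: fun_scale_def fun_eq_iff plus_fun_apply distrib_left distrib_right
      mult.assoc mult_1_left simp_thms)

definition poly_on :: "(complex ^ 'n) set \<Rightarrow> 'n::finite cpoly \<Rightarrow> complex ^ 'n \<Rightarrow> complex" where
  "poly_on \<Omega> p = (\<lambda>z. if z \<in> \<Omega> then poly_eval p z else 0)"

text \<open>For use on open sets only: the real derivative exists and is complex linear.\<close>

definition holomorphic_several_on :: "(complex ^ 'n::finite \<Rightarrow> complex) \<Rightarrow> (complex ^ 'n) set \<Rightarrow> bool"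
  where
  "holomorphic_several_on f \<Omega> \<longleftrightarrow>
    (\<forall>z\<in>\<Omega>. \<exists>L. (f has_derivative L) (at z) \<and> (\<forall>c v. L (c *s v) = c * L v))"

text \<open>
  Wirtinger derivative with respect to the conjugate of \<open>w\<^sub>j = x\<^sub>j + \<i> y\<^sub>j\<close>:
  \<open>(\<partial>/\<partial>x\<^sub>j + \<i> \<partial>/\<partial>y\<^sub>j) / 2\<close>.
\<close>

definition dbar :: "'n::finite \<Rightarrow> (complex ^ 'n \<Rightarrow> complex) \<Rightarrow> complex ^ 'n \<Rightarrow> complex" where
  "dbar j g w =
    (frechet_derivative g (at w) (axis j 1) + \<i> * frechet_derivative g (at w) (axis j \<i>)) / 2"

text \<open>
  The iterated partial derivatives are taken in the order of some enumeration of the variables.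
  The order is immaterial for smooth functions, in particular for \<open>K z\<close> with \<open>K\<close> a
  reproducing kernel of holomorphic functions.
\<close>

definition dbar_multi ::
  "('n::finite \<Rightarrow>\<^sub>0 nat) \<Rightarrow> (complex ^ 'n \<Rightarrow> complex) \<Rightarrow> complex ^ 'n \<Rightarrow> complex" where
  "dbar_multi \<alpha> g =
    foldr (\<lambda>j. dbar j ^^ Poly_Mapping.lookup \<alpha> j) (SOME js. distinct js \<and> set js = UNIV) g"

text \<open>\<open>q\<close> applied to the antiholomorphic partial derivatives in the second variable of \<open>K\<close>,
  taken at \<open>w\<close>, as a function of the first variable.\<close>

definition poly_dbar_kernel ::
  "'n::finite cpoly \<Rightarrow> (complex ^ 'n \<Rightarrow> complex ^ 'n \<Rightarrow> complex) \<Rightarrow> complex ^ 'n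
    \<Rightarrow> complex ^ 'n \<Rightarrow> complex" where
  "poly_dbar_kernel q K w =
    (\<lambda>z. \<Sum>\<alpha>\<in>Poly_Mapping.keys q. Poly_Mapping.lookup q \<alpha> * dbar_multi \<alpha> (\<lambda>u. K z u) w)"


section \<open>Hilbert modules\<close>

type_synonym 'n cfun_inner = "(complex ^ 'n \<Rightarrow> complex) \<Rightarrow> (complex ^ 'n \<Rightarrow> complex) \<Rightarrow> complex"

definition ip_norm :: "'n::finite cfun_inner \<Rightarrow> (complex ^ 'n \<Rightarrow> complex) \<Rightarrow> real" where
  "ip_norm ip f = sqrt (Re (ip f f))"

text \<open>Inner products are linear in the first argument.\<close>

locale hilbert_function_space =
  fixes \<Omega> :: "(complex ^ 'n::finite) set"
    and H :: "(complex ^ 'n \<Rightarrow> complex) set"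
    and ip :: "'n cfun_inner"
  assumes subspace: "cfun.subspace H"
    and holomorphic: "f \<in> H \<Longrightarrow> holomorphic_several_on f \<Omega>"
    and zero_outside: "f \<in> H \<Longrightarrow> z \<notin> \<Omega> \<Longrightarrow> f z = 0"
    and ip_add: "f \<in> H \<Longrightarrow> g \<in> H \<Longrightarrow> h \<in> H \<Longrightarrow> ip (f + g) h = ip f h + ip g h"
    and ip_scale: "f \<in> H \<Longrightarrow> g \<in> H \<Longrightarrow> ip (fun_scale c f) g = c * ip f g"
    and ip_cnj: "f \<in> H \<Longrightarrow> g \<in> H \<Longrightarrow> ip g f = cnj (ip f g)"
    and ip_pos: "f \<in> H \<Longrightarrow> f \<noteq> 0 \<Longrightarrow> 0 < Re (ip f f)"
    and complete:
      "(\<And>n::nat. F n \<in> H) \<Longrightarrow>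
       (\<forall>e>0. \<exists>N. \<forall>m\<ge>N. \<forall>n\<ge>N. ip_norm ip (F m - F n) < e) \<Longrightarrow>
       \<exists>g\<in>H. (\<lambda>n. ip_norm ip (F n - g)) \<longlonglongrightarrow> 0"

definition coord_mult :: "'n::finite \<Rightarrow> (complex ^ 'n \<Rightarrow> complex) \<Rightarrow> complex ^ 'n \<Rightarrow> complex" where
  "coord_mult j f = (\<lambda>z. z $ j * f z)"

locale hilbert_module = hilbert_function_space +
  assumes coord_mult_closed: "f \<in> H \<Longrightarrow> coord_mult j f \<in> H"
    and coord_mult_bounded:
      "\<exists>C. \<forall>f\<in>H. ip_norm ip (coord_mult j f) \<le> C * ip_norm ip f"

text \<open>For a bounded operator \<open>T\<close> on \<open>H\<close> the description below determines a unique operator.\<close>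

definition adjoint_on ::
  "(complex ^ 'n::finite \<Rightarrow> complex) set \<Rightarrow> 'n cfun_inner
    \<Rightarrow> ((complex ^ 'n \<Rightarrow> complex) \<Rightarrow> (complex ^ 'n \<Rightarrow> complex))
    \<Rightarrow> ((complex ^ 'n \<Rightarrow> complex) \<Rightarrow> (complex ^ 'n \<Rightarrow> complex))" where
  "adjoint_on H ip T g = (THE h. h \<in> H \<and> (\<forall>f\<in>H. ip (T f) g = ip f h))"

definition kernel_on ::
  "(complex ^ 'n::finite \<Rightarrow> complex) set
    \<Rightarrow> ((complex ^ 'n \<Rightarrow> complex) \<Rightarrow> (complex ^ 'n \<Rightarrow> complex))
    \<Rightarrow> (complex ^ 'n \<Rightarrow> complex) set" where
  "kernel_on H T = {g \<in> H. T g = 0}"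

definition reproducing_kernel ::
  "(complex ^ 'n::finite) set \<Rightarrow> (complex ^ 'n \<Rightarrow> complex) set \<Rightarrow> 'n cfun_inner
    \<Rightarrow> (complex ^ 'n \<Rightarrow> complex ^ 'n \<Rightarrow> complex) \<Rightarrow> bool" where
  "reproducing_kernel \<Omega> H ip K \<longleftrightarrow>
    (\<forall>w\<in>\<Omega>. (\<lambda>z. K z w) \<in> H \<and> (\<forall>f\<in>H. ip f (\<lambda>z. K z w) = f w))"

definition ideal_times ::
  "'n::finite cpoly set \<Rightarrow> (complex ^ 'n \<Rightarrow> complex) set \<Rightarrow> (complex ^ 'n \<Rightarrow> complex) set" where
  "ideal_times J H = cfun.span {(\<lambda>z. poly_eval p z * f z) | p f. p \<in> J \<and> f \<in> H}"

text \<open>\<open>dim (H / N) < \<infinity>\<close>: finitely many cosets span the quotient.\<close>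

definition finite_dim_quotient :: "('a \<Rightarrow> complex) set \<Rightarrow> ('a \<Rightarrow> complex) set \<Rightarrow> bool" where
  "finite_dim_quotient H N \<longleftrightarrow>
    (\<exists>B. finite B \<and> B \<subseteq> H \<and> (\<forall>f\<in>H. \<exists>b\<in>cfun.span B. f - b \<in> N))"

text \<open>
  The class \<open>\<BB>\<^sub>1(\<Omega>\<^sup>*)\<close>, given in terms of \<open>\<Omega>\<close>. The kernel may vanish on the diagonal.
\<close>

definition class_B1 ::
  "(complex ^ 'n::finite) set \<Rightarrow> (complex ^ 'n \<Rightarrow> complex) set \<Rightarrow> 'n cfun_inner \<Rightarrow> bool" where
  "class_B1 \<Omega> H ip \<longleftrightarrow>
    hilbert_module \<Omega> H ip \<and>
    (\<exists>K. reproducing_kernel \<Omega> H ip K) \<and>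
    (\<forall>w\<in>\<Omega>. finite_dim_quotient H (ideal_times (maximal_ideal_at w) H))"

text \<open>\<open>H\<close> is a Hilbert module \<open>[I]\<close>.\<close>

definition completion_module ::
  "(complex ^ 'n::finite) set \<Rightarrow> 'n cpoly set \<Rightarrow> (complex ^ 'n \<Rightarrow> complex) set
    \<Rightarrow> 'n cfun_inner \<Rightarrow> bool" where
  "completion_module \<Omega> I H ip \<longleftrightarrow>
    hilbert_module \<Omega> H ip \<and>
    poly_on \<Omega> ` I \<subseteq> H \<and>
    (\<forall>f\<in>H. \<forall>e>0. \<exists>p\<in>I. ip_norm ip (f - poly_on \<Omega> p) < e)"

end

theory Submission
  imports Defs "HOL-Complex_Analysis.Cauchy_Integral_Formula"
begin

text \<open>
  The space \<open>\<Inter>\<^sub>j ker M\<^sub>j\<^sup>*\<close> is the orthogonal complement of \<open>\<mm>\<^sub>0 I\<close> in the completion of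
  \<open>I\<close>, where \<open>\<mm>\<^sub>0\<close> is the maximal ideal at the origin, and pairing a polynomial
  \<open>f\<close> with \<open>poly_dbar_kernel q K 0\<close> gives
  \<open>\<Sum>\<^sub>\<alpha> \<alpha>! f\<^sub>\<alpha> cnj q\<^sub>\<alpha>\<close>, the Fischer inner product
  \<open>\<langle>f, q\<rangle>\<^sub>F\<close>, whatever the inner product of the module is (\<open>ip_poly_dbar_kernel\<close>).  So it suffices
  to find generators of \<open>I\<close> that are Fischer-orthogonal to \<open>\<mm>\<^sub>0 I\<close>: the resulting vectors lie in the
  common kernel, and they are independent because the Fischer form is definite on the span of the generators.
  They exhaust the common kernel: a vector \<open>g\<close> in it defines a functional on
  \<open>I\<close> that vanishes on \<open>\<mm>\<^sub>0 I\<close>, the generators span \<open>I\<close> modulo \<open>\<mm>\<^sub>0 I\<close>, and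
  finite-dimensional duality provides a combination \<open>u\<close> of them that represents this functional in the Fischer
  product; by density of \<open>I\<close>, \<open>g\<close> equals \<open>poly_dbar_kernel u K 0\<close>.

  The generators (\<open>orthogonal_generators\<close>) are \<open>q\<^sub>i = p\<^sub>i - w\<^sub>i\<close>, with \<open>w\<^sub>i\<close> the
  Fischer projection of \<open>p\<^sub>i\<close> to the component of \<open>\<mm>\<^sub>0 I\<close> of the same degree as \<open>p\<^sub>i\<close>.
  Different degrees are orthogonal, so \<open>q\<^sub>i\<close> is orthogonal to all of \<open>\<mm>\<^sub>0 I\<close>.  Since
  \<open>w\<^sub>i\<close> is a polynomial combination of generators of lower degree, an induction on the degree shows that the
  \<open>q\<^sub>i\<close> generate \<open>I\<close>, and a linear relation between them would express some \<open>p\<^sub>i\<close> by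
  the other ones, against minimality.

  The analytic part is that the derivatives of \<open>K(z, \<cdot>)\<close> at the origin, as functions of \<open>z\<close>, belong to the
  module and represent the derivatives of its elements (\<open>dbar_multi_kernel\<close>).  A partial derivative is a
  pointwise limit of difference quotients; if the values of a differential operator are represented by vectors,
  so are the difference quotients, and by uniform boundedness and Riesz representation the limit is represented
  too (\<open>weak_limit_exists\<close>).  To iterate, partial derivatives of holomorphic functions of several
  variables must be holomorphic again, which is read off from Cauchy's integral formula
  (\<open>holomorphic_several_on_cpartial\<close>).
\<close>

section \<open>Riesz representation and weak limits\<close>

lemma (in hilbert_function_space) zero_mem [simp]: "0 \<in> H"
  using subspace by (rule cfun.subspace_0)

lemma (in hilbert_function_space) add_mem [intro]: "f \<in> H \<Longrightarrow> g \<in> H \<Longrightarrow> f + g \<in> H"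
  using subspace by (rule cfun.subspace_add)

lemma (in hilbert_function_space) scale_mem [intro]: "f \<in> H \<Longrightarrow> fun_scale c f \<in> H"
  using subspace by (rule cfun.subspace_scale)

lemma (in hilbert_function_space) diff_mem [intro]: "f \<in> H \<Longrightarrow> g \<in> H \<Longrightarrow> f - g \<in> H"
  using subspace by (rule cfun.subspace_diff)

lemma (in hilbert_function_space) sum_mem [intro]: "(\<And>x. x \<in> A \<Longrightarrow> f x \<in> H) \<Longrightarrow> sum f A \<in> H"
  using subspace by (rule cfun.subspace_sum)

lemma (in hilbert_function_space) ip_zero_left: "g \<in> H \<Longrightarrow> ip 0 g = 0"
  using ip_add[of 0 0 g] by simp

lemma (in hilbert_function_space) ip_diff: 
  "f \<in> H \<Longrightarrow> g \<in> H \<Longrightarrow> h \<in> H \<Longrightarrow> ip (f - g) h = ip f h - ip g h"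
  using ip_add[of "f - g" g h] by (simp add: diff_mem)

lemma (in hilbert_function_space) ip_zero_right: "g \<in> H \<Longrightarrow> ip g 0 = 0"
  using ip_cnj[of 0 g] by (simp add: ip_zero_left)

lemma (in hilbert_function_space) ip_add_right: 
  "f \<in> H \<Longrightarrow> g \<in> H \<Longrightarrow> h \<in> H \<Longrightarrow> ip h (f + g) = ip h f + ip h g"
  by (simp add: ip_cnj[of _ h] add_mem ip_add)

lemma (in hilbert_function_space) ip_diff_right: 
  "f \<in> H \<Longrightarrow> g \<in> H \<Longrightarrow> h \<in> H \<Longrightarrow> ip h (f - g) = ip h f - ip h g"
  by (simp add: ip_cnj[of _ h] diff_mem ip_diff)

lemma (in hilbert_function_space) ip_scale_right: 
  "f \<in> H \<Longrightarrow> g \<in> H \<Longrightarrow> ip g (fun_scale c f) = cnj c * ip g f"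
  by (simp add: ip_cnj[of _ g] scale_mem ip_scale)

lemma (in hilbert_function_space) ip_sum_right: 
  assumes "\<And>x. x \<in> A \<Longrightarrow> f x \<in> H" "h \<in> H"
  shows "ip h (sum f A) = (\<Sum>x\<in>A. ip h (f x))"
  using assms by (induction A rule: infinite_finite_induct) (auto simp: ip_zero_right ip_add_right sum_mem)

lemma (in hilbert_function_space) ip_self_nonneg: "f \<in> H \<Longrightarrow> 0 \<le> Re (ip f f)"
  using ip_pos[of f] ip_zero_left[of 0] by (cases "f = 0") auto

lemma (in hilbert_function_space) ip_self: 
  assumes "f \<in> H" shows "ip f f = of_real ((ip_norm ip f)\<^sup>2)"
proof -
  have "Im (ip f f) = 0" using arg_cong[OF ip_cnj[OF assms assms], of Im] by simp
  then show ?thesis using ip_self_nonneg[OF assms] by (simp add: ip_norm_def complex_eq_iff)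
qed

lemma (in hilbert_function_space) norm_nonneg: "f \<in> H \<Longrightarrow> 0 \<le> ip_norm ip f"
  using ip_self_nonneg by (simp add: ip_norm_def)

lemma (in hilbert_function_space) norm_eq_0_iff: "f \<in> H \<Longrightarrow> ip_norm ip f = 0 \<longleftrightarrow> f = 0"
  using ip_pos[of f] ip_zero_left[of 0] by (cases "f = 0") (auto simp: ip_norm_def)

lemma (in hilbert_function_space) norm_scale: 
  assumes "f \<in> H" shows "ip_norm ip (fun_scale c f) = cmod c * ip_norm ip f"
proof -
  have "ip (fun_scale c f) (fun_scale c f) = of_real ((cmod c * ip_norm ip f)\<^sup>2)"
    using complex_norm_square[of c]
    by (simp add: ip_scale ip_scale_right scale_mem assms ip_self[OF assms] power_mult_distrib mult.assoc [symmetric])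
  then have "Re (ip (fun_scale c f) (fun_scale c f)) = (cmod c * ip_norm ip f)\<^sup>2"
    by (metis Re_complex_of_real)
  then show ?thesis using norm_nonneg[OF assms] unfolding ip_norm_def[of _ "fun_scale c f"] by simp
qed

lemma (in hilbert_function_space) norm_add_square:
  assumes "f \<in> H" "g \<in> H"
  shows "(ip_norm ip (f + g))\<^sup>2 = (ip_norm ip f)\<^sup>2 + (ip_norm ip g)\<^sup>2 + 2 * Re (ip f g)"
proof -
  have "Re (ip (f + g) (f + g)) = Re (ip f f) + Re (ip g g) + 2 * Re (ip f g)"
    using assms ip_cnj[of f g] by (simp add: ip_add ip_add_right add_mem)
  then show ?thesis using assms by (simp add: ip_self add_mem)
qed

lemma (in hilbert_function_space) norm_diff_square:
  assumes "f \<in> H" "g \<in> H"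
  shows "(ip_norm ip (f - g))\<^sup>2 = (ip_norm ip f)\<^sup>2 + (ip_norm ip g)\<^sup>2 - 2 * Re (ip f g)"
proof -
  have "Re (ip (f - g) (f - g)) = Re (ip f f) + Re (ip g g) - 2 * Re (ip f g)"
    using assms ip_cnj[of f g] by (simp add: ip_diff ip_diff_right diff_mem)
  then show ?thesis using assms by (simp add: ip_self diff_mem)
qed

lemma (in hilbert_function_space) Cauchy_Schwarz:
  assumes "f \<in> H" "g \<in> H"
  shows "cmod (ip f g) \<le> ip_norm ip f * ip_norm ip g"
proof (cases "g = 0")
  case True
  then show ?thesis using assms by (simp add: ip_zero_right norm_nonneg)
next
  case False
  define n where "n = (ip_norm ip g)\<^sup>2"
  have n: "n > 0" using False assms norm_eq_0_iff[of g] by (simp add: n_def)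
  define c where "c = - ip f g / of_real n"
  have "0 \<le> (ip_norm ip (f + fun_scale c g))\<^sup>2" by simp
  also have "\<dots> = (ip_norm ip f)\<^sup>2 + (cmod c)\<^sup>2 * n + 2 * Re (cnj c * ip f g)"
    using assms by (simp add: norm_add_square scale_mem norm_scale ip_scale_right power_mult_distrib n_def)
  also have "(cmod c)\<^sup>2 * n = (cmod (ip f g))\<^sup>2 / n"
    using n by (simp add: c_def norm_divide power_divide power2_eq_square)
  also have "cnj c * ip f g = of_real (- (cmod (ip f g))\<^sup>2 / n)"
    using complex_norm_square[of "ip f g"] by (simp add: c_def mult.commute)
  finally have "(cmod (ip f g))\<^sup>2 / n \<le> (ip_norm ip f)\<^sup>2" by simp
  then have "(cmod (ip f g))\<^sup>2 \<le> (ip_norm ip f * ip_norm ip g)\<^sup>2"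
    using n by (simp add: field_simps n_def)
  then show ?thesis using assms by (intro power2_le_imp_le[of "cmod (ip f g)"]) (auto simp: norm_nonneg)
qed

lemma (in hilbert_function_space) norm_triangle:
  assumes "f \<in> H" "g \<in> H"
  shows "ip_norm ip (f + g) \<le> ip_norm ip f + ip_norm ip g"
proof (rule power2_le_imp_le)
  have "Re (ip f g) \<le> ip_norm ip f * ip_norm ip g"
    using Cauchy_Schwarz[OF assms] complex_Re_le_cmod order_trans by blast
  then show "(ip_norm ip (f + g))\<^sup>2 \<le> (ip_norm ip f + ip_norm ip g)\<^sup>2"
    using assms by (simp add: norm_add_square power2_sum)
qed (use assms in \<open>auto simp: norm_nonneg\<close>)

lemma (in hilbert_function_space) norm_minus_commute:
  assumes "f \<in> H" "g \<in> H"
  shows "ip_norm ip (f - g) = ip_norm ip (g - f)"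
proof -
  have "f - g = fun_scale (-1) (g - f)" by (auto simp: fun_scale_def fun_eq_iff)
  then show ?thesis using assms norm_scale[OF diff_mem, of g f "-1"] by simp
qed

lemma (in hilbert_function_space) norm_diff_triangle:
  assumes "f \<in> H" "g \<in> H" "h \<in> H"
  shows "ip_norm ip (f - h) \<le> ip_norm ip (f - g) + ip_norm ip (g - h)"
  using norm_triangle[of "f - g" "g - h"] assms by (simp add: diff_mem)

lemma real_quadratic_nonneg_imp_linear_coeff_0:
  fixes a b :: real
  assumes "\<And>t. 0 \<le> t\<^sup>2 * a + 2 * t * b" "0 \<le> a"
  shows "b = 0"
proof -
  define t where "t = - b / (a + 1)"
  have b: "b = - t * (a + 1)" using assms(2) by (simp add: t_def)
  have "t\<^sup>2 * a + 2 * t * b = - (t\<^sup>2 * (a + 2))" unfolding b by (simp add: algebra_simps power2_eq_square)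
  then have "t\<^sup>2 * (a + 2) \<le> 0" using assms(1)[of t] by linarith
  then have "t = 0" using assms(2) by (simp add: mult_le_0_iff)
  then show ?thesis by (simp add: b)
qed

text \<open>
  The representing vector minimizes \<open>\<parallel>f\<parallel>\<^sup>2 - 2 Re (\<phi> f)\<close>, which equals
  \<open>\<parallel>f - g\<parallel>\<^sup>2 - \<parallel>g\<parallel>\<^sup>2\<close> if \<open>\<phi>\<close> is the pairing with \<open>g\<close>.
\<close>

theorem (in hilbert_function_space) Riesz_representation:
  assumes add: "\<And>f g. f \<in> H \<Longrightarrow> g \<in> H \<Longrightarrow> \<phi> (f + g) = \<phi> f + \<phi> g"
    and scale: "\<And>c f. f \<in> H \<Longrightarrow> \<phi> (fun_scale c f) = c * \<phi> f"
    and bound: "\<And>f. f \<in> H \<Longrightarrow> cmod (\<phi> f) \<le> C * ip_norm ip f"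
  shows "\<exists>g\<in>H. \<forall>f\<in>H. \<phi> f = ip f g"
proof -
  define J where "J f = (ip_norm ip f)\<^sup>2 - 2 * Re (\<phi> f)" for f
  have diff: "\<phi> (f - g) = \<phi> f - \<phi> g" if "f \<in> H" "g \<in> H" for f g
    using add[of "f - g" g] that by (simp add: diff_mem)
  have "- C\<^sup>2 \<le> J f" if "f \<in> H" for f
  proof -
    have "Re (\<phi> f) \<le> C * ip_norm ip f" using bound[OF that] complex_Re_le_cmod order_trans by blast
    moreover have "0 \<le> (ip_norm ip f - C)\<^sup>2" by simp
    ultimately show ?thesis unfolding J_def by (simp add: power2_diff algebra_simps)
  qed
  then have bdd: "bdd_below (J ` H)" by (auto simp: bdd_below_def)
  define m where "m = Inf (J ` H)"
  have m_le: "m \<le> J f" if "f \<in> H" for f unfolding m_def using bdd that by (auto intro: cInf_lower)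
  have "\<exists>f\<in>H. J f < m + e" if "e > 0" for e
  proof -
    have "J ` H \<noteq> {}" "Inf (J ` H) < m + e" using zero_mem that by (blast, simp add: m_def)
    from cInf_lessD[OF this] show ?thesis by blast
  qed
  then have "\<exists>F. \<forall>n::nat. F n \<in> H \<and> J (F n) < m + inverse (real (Suc n))"
    by (intro choice) (metis inverse_positive_iff_positive of_nat_0_less_iff zero_less_Suc)
  then obtain F where F: "\<And>n. F n \<in> H" "\<And>n. J (F n) < m + inverse (real (Suc n))" by blast
  \<comment> \<open>The parallelogram law makes minimizing sequences Cauchy.\<close>
  have par: "(ip_norm ip (f - g))\<^sup>2 \<le> 2 * (J f - m) + 2 * (J g - m)" if fg: "f \<in> H" "g \<in> H" for f g
  proof -
    define h where "h = fun_scale (1/2) (f + g)"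
    have h: "h \<in> H" using fg by (auto simp: h_def)
    have "J h = (ip_norm ip (f + g))\<^sup>2 / 4 - Re (\<phi> f) - Re (\<phi> g)"
      using fg by (simp add: J_def h_def norm_scale scale add add_mem power_divide add_divide_distrib)
    moreover have "(ip_norm ip (f + g))\<^sup>2 + (ip_norm ip (f - g))\<^sup>2 = 2 * (ip_norm ip f)\<^sup>2 + 2 * (ip_norm ip g)\<^sup>2"
      using fg by (simp add: norm_add_square norm_diff_square)
    ultimately show ?thesis using m_le[OF h] by (simp add: J_def)
  qed
  have cauchy: "\<forall>e>0. \<exists>N. \<forall>m\<ge>N. \<forall>n\<ge>N. ip_norm ip (F m - F n) < e"
  proof (intro allI impI)
    fix e :: real assume e: "e > 0"
    then obtain N where N: "inverse (real (Suc N)) < e\<^sup>2 / 4" using reals_Archimedean[of "e\<^sup>2/4"] by auto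
    have small: "J (F n) - m < e\<^sup>2 / 4" if "n \<ge> N" for n
    proof -
      have "inverse (real (Suc n)) \<le> inverse (real (Suc N))" using that by (simp add: field_simps)
      then show ?thesis using F(2)[of n] N by linarith
    qed
    have "ip_norm ip (F i - F j) < e" if "i \<ge> N" "j \<ge> N" for i j
      using par[OF F(1) F(1), of i j] small[OF that(1)] small[OF that(2)] e
      by (intro power2_less_imp_less[of _ e]) auto
    then show "\<exists>N. \<forall>m\<ge>N. \<forall>n\<ge>N. ip_norm ip (F m - F n) < e" by blast
  qed
  obtain g where g: "g \<in> H" "(\<lambda>n. ip_norm ip (F n - g)) \<longlonglongrightarrow> 0"
    using complete[OF F(1) cauchy] by blast
  have "(\<lambda>n. \<phi> (F n) - \<phi> g) \<longlonglongrightarrow> 0"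
  proof (rule Lim_null_comparison)
    show "(\<lambda>n. C * ip_norm ip (F n - g)) \<longlonglongrightarrow> 0" using tendsto_mult_right_zero[OF g(2)] .
    show "\<forall>\<^sub>F n in sequentially. cmod (\<phi> (F n) - \<phi> g) \<le> C * ip_norm ip (F n - g)"
      using bound[of "F _ - g"] F g by (intro always_eventually) (simp add: diff diff_mem)
  qed
  then have lim_phi: "(\<lambda>n. \<phi> (F n)) \<longlonglongrightarrow> \<phi> g" by (simp add: LIM_zero_iff)
  have "(\<lambda>n. ip_norm ip (F n) - ip_norm ip g) \<longlonglongrightarrow> 0"
  proof (rule Lim_null_comparison[OF _ g(2)], rule always_eventually, rule allI)
    fix n
    show "norm (ip_norm ip (F n) - ip_norm ip g) \<le> ip_norm ip (F n - g)"
      using norm_triangle[of "F n - g" g] norm_triangle[of "g - F n" "F n"] norm_minus_commute[of "F n" g] F g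
      by (simp add: diff_mem abs_le_iff)
  qed
  then have "(\<lambda>n. ip_norm ip (F n)) \<longlonglongrightarrow> ip_norm ip g" by (simp add: LIM_zero_iff)
  then have "(\<lambda>n. J (F n)) \<longlonglongrightarrow> J g" unfolding J_def by (intro tendsto_intros lim_phi)
  moreover have "(\<lambda>n. m + inverse (real (Suc n))) \<longlonglongrightarrow> m" 
    using tendsto_add[OF tendsto_const LIMSEQ_inverse_real_of_nat] by simp
  ultimately have "J g \<le> m" using F(2) by (intro LIMSEQ_le) (auto intro: less_imp_le)
  \<comment> \<open>First variation at the minimizer; the imaginary parts follow with \<open>\<i> h\<close> in place of \<open>h\<close>.\<close>
  have re: "Re (\<phi> h) = Re (ip h g)" if h: "h \<in> H" for h
  proof -
    have "0 \<le> t\<^sup>2 * (ip_norm ip h)\<^sup>2 + 2 * t * (Re (ip h g) - Re (\<phi> h))" for t :: real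
    proof -
      have "J g \<le> J (g + fun_scale t h)" using \<open>J g \<le> m\<close> m_le[OF add_mem[OF g(1) scale_mem[OF h]], of t] by linarith
      moreover have "Re (ip g h) = Re (ip h g)" using ip_cnj[of h g] g h by simp
      ultimately show ?thesis using g h
        by (simp add: J_def norm_add_square scale_mem norm_scale ip_scale_right add scale power_mult_distrib algebra_simps)
    qed
    then show ?thesis using real_quadratic_nonneg_imp_linear_coeff_0[of "(ip_norm ip h)\<^sup>2" "Re (ip h g) - Re (\<phi> h)"] by simp
  qed
  have "\<phi> h = ip h g" if h: "h \<in> H" for h
    using re[OF h] re[OF scale_mem[OF h, of \<i>]] h g by (simp add: complex_eq_iff scale ip_scale)
  then show ?thesis using g by blast
qed

text \<open>
  A gliding hump: if the norms are unbounded, choose a subsequence with \<open>\<parallel>g (N k)\<parallel> > 4\<^sup>k\<close> and add up, with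
  suitable signs, vectors of norm \<open>3\<^sup>-\<^sup>k\<close> in the directions \<open>g (N k)\<close>.  The sign makes the pairing of the
  \<open>k\<close>-th partial sum with \<open>g (N k)\<close> at least \<open>3\<^sup>-\<^sup>k \<parallel>g (N k)\<parallel>\<close>, and the remaining terms add up to norm
  at most \<open>3\<^sup>-\<^sup>k / 2\<close>, so they cannot destroy it.  The limit pairs with \<open>g (N k)\<close> to at least
  \<open>(4/3)\<^sup>k / 2\<close>.
\<close>

theorem (in hilbert_function_space) uniform_boundedness:
  assumes g: "\<And>n::nat. g n \<in> H" and bdd: "\<And>f. f \<in> H \<Longrightarrow> \<exists>B. \<forall>n. cmod (ip f (g n)) \<le> B"
  shows "\<exists>C. \<forall>n. ip_norm ip (g n) \<le> C"
proof (rule ccontr)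
  assume neg: "\<not> ?thesis"
  then have "\<forall>k::nat. \<exists>n. ip_norm ip (g n) > 4 ^ k" by (meson not_le)
  then obtain N where N: "\<And>k::nat. ip_norm ip (g (N k)) > 4 ^ k" by metis
  have npos: "ip_norm ip (g (N k)) > 0" for k using N[of k] by (smt (verit) zero_less_power)
  define u where "u k = fun_scale (of_real ((1/3)^k / ip_norm ip (g (N k)))) (g (N k))" for k
  have u: "u k \<in> H" for k using g by (auto simp: u_def)
  have norm_u: "ip_norm ip (u k) = (1/3)^k" for k
    using npos[of k] g by (simp add: u_def norm_scale norm_divide norm_power)
  have ip_u: "ip (u k) (g (N k)) = of_real ((1/3)^k * ip_norm ip (g (N k)))" for k
    using npos[of k] g by (simp add: u_def ip_scale ip_self power2_eq_square)
  define x where "x = rec_nat 0 (\<lambda>k y. if cmod (ip (y + u k) (g (N k))) \<ge> (1/3)^k * ip_norm ip (g (N k)) then y + u k else y - u k)"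
  have x_Suc: "x (Suc k) = (if cmod (ip (x k + u k) (g (N k))) \<ge> (1/3)^k * ip_norm ip (g (N k)) then x k + u k else x k - u k)" for k
    by (simp add: x_def)
  have x: "x k \<in> H" for k
  proof (induction k)
    case 0 show ?case by (simp only: x_def nat.rec zero_mem)
  next
    case (Suc k) then show ?case using u[of k] by (auto simp: x_Suc)
  qed
  \<comment> \<open>The two candidates differ by \<open>2 u k\<close>, so one of them pairs with \<open>g (N k)\<close> as strongly as \<open>u k\<close> does.\<close>
  have big: "cmod (ip (x (Suc k)) (g (N k))) \<ge> (1/3)^k * ip_norm ip (g (N k))" for k
  proof -
    define a b where "a = ip (x k + u k) (g (N k))" and "b = ip (x k - u k) (g (N k))"
    have "a - b = 2 * ip (u k) (g (N k))" using x u g by (simp add: a_def b_def ip_add ip_diff)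
    then have "cmod (a - b) = 2 * ((1/3)^k * ip_norm ip (g (N k)))"
      using npos[of k] by (simp add: ip_u norm_mult norm_power)
    then have "cmod a + cmod b \<ge> 2 * ((1/3)^k * ip_norm ip (g (N k)))" using norm_triangle_ineq4[of a b] by simp
    then show ?thesis by (auto simp: x_Suc a_def b_def)
  qed
  have step: "ip_norm ip (x (Suc k) - x k) = (1/3)^k" for k
  proof -
    have "x k - u k - x k = fun_scale (-1) (u k)" "x k + u k - x k = u k" 
      by (auto simp: fun_scale_def fun_eq_iff)
    then have "x (Suc k) - x k = u k \<or> x (Suc k) - x k = fun_scale (-1) (u k)" by (metis x_Suc)
    then show ?thesis using norm_u[of k] norm_scale[OF u, of "-1" k] by auto
  qed
  have tail: "ip_norm ip (x (i + k) - x k) \<le> 3/2 * ((1/3)^k - (1/3)^(i + k))" for i k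
  proof (induction i)
    case 0
    have "ip_norm ip (x (0 + k) - x k) = 0" by (simp only: add_0 diff_self norm_eq_0_iff zero_mem)
    then show ?case by (simp only: add_0 diff_self mult_zero_right order_refl)
  next
    case (Suc i)
    have "ip_norm ip (x (Suc i + k) - x k) \<le> (1/3)^(i+k) + ip_norm ip (x (i + k) - x k)"
      using norm_diff_triangle[of "x (Suc (i + k))" "x (i + k)" "x k", OF x x x] step[of "i + k"]
      unfolding add_Suc by linarith
    moreover have "s \<le> 3/2 * (b - 1/3 * a)" if "s \<le> a + t" "t \<le> 3/2 * (b - a)" for s t a b :: real
      using that by (simp add: field_simps)
    ultimately show ?case using Suc unfolding add_Suc power_Suc by blast
  qed
  have tail': "ip_norm ip (x n - x k) \<le> 3/2 * (1/3)^k" if "n \<ge> k" for n k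
  proof -
    have "ip_norm ip (x n - x k) \<le> 3/2 * ((1/3)^k - (1/3)^n)" using tail[of "n - k" k] that by simp
    also have "\<dots> \<le> 3/2 * (1/3)^k" by simp
    finally show ?thesis .
  qed
  have cauchy: "\<forall>e>0. \<exists>N. \<forall>m\<ge>N. \<forall>n\<ge>N. ip_norm ip (x m - x n) < e"
  proof (intro allI impI)
    fix e :: real assume e: "e > 0"
    obtain k where k: "(1/3::real)^k < e/3" using real_arch_pow_inv[of "e/3" "1/3"] e by auto
    have "ip_norm ip (x i - x j) < e" if "i \<ge> k" "j \<ge> k" for i j
    proof -
      have "ip_norm ip (x i - x j) \<le> ip_norm ip (x i - x k) + ip_norm ip (x j - x k)"
        using norm_diff_triangle[of "x i" "x k" "x j", OF x x x] norm_minus_commute[OF x x, of k j] by simp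
      then show ?thesis using tail'[OF that(1)] tail'[OF that(2)] k by linarith
    qed
    then show "\<exists>N. \<forall>m\<ge>N. \<forall>n\<ge>N. ip_norm ip (x m - x n) < e" by blast
  qed
  obtain y where y: "y \<in> H" "(\<lambda>n. ip_norm ip (x n - y)) \<longlonglongrightarrow> 0"
    using complete[OF x cauchy] by blast
  have near: "ip_norm ip (x (Suc k) - y) \<le> 1/2 * (1/3)^k" for k
  proof (rule LIMSEQ_le_const)
    show "(\<lambda>n. 3/2 * (1/3)^(Suc k) + ip_norm ip (x n - y)) \<longlonglongrightarrow> 1/2 * (1/3)^k"
      using tendsto_add[OF tendsto_const[of "3/2 * (1/3)^(Suc k)"] y(2)] by simp
    show "\<exists>N. \<forall>n\<ge>N. ip_norm ip (x (Suc k) - y) \<le> 3/2 * (1/3)^(Suc k) + ip_norm ip (x n - y)"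
    proof (intro exI allI impI)
      fix n assume n: "n \<ge> Suc k"
      have "ip_norm ip (x (Suc k) - y) \<le> ip_norm ip (x n - x (Suc k)) + ip_norm ip (x n - y)"
        using norm_diff_triangle[of "x (Suc k)" "x n" y, OF x x y(1)] norm_minus_commute[OF x x, of "Suc k" n] by simp
      then show "ip_norm ip (x (Suc k) - y) \<le> 3/2 * (1/3)^(Suc k) + ip_norm ip (x n - y)" using tail'[OF n] by linarith
    qed
  qed
  have large: "cmod (ip y (g (N k))) \<ge> 1/2 * (4/3)^k" for k
  proof -
    have "ip (x (Suc k)) (g (N k)) = ip y (g (N k)) + ip (x (Suc k) - y) (g (N k))"
      using x y g by (simp add: ip_diff)
    then have "cmod (ip y (g (N k))) \<ge> cmod (ip (x (Suc k)) (g (N k))) - cmod (ip (x (Suc k) - y) (g (N k)))"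
      using norm_triangle_ineq[of "ip y (g (N k))" "ip (x (Suc k) - y) (g (N k))"] by simp
    moreover have "cmod (ip (x (Suc k) - y) (g (N k))) \<le> 1/2 * (1/3)^k * ip_norm ip (g (N k))"
    proof (rule order_trans[OF Cauchy_Schwarz])
      show "ip_norm ip (x (Suc k) - y) * ip_norm ip (g (N k)) \<le> 1/2 * (1/3)^k * ip_norm ip (g (N k))"
        using near[of k] npos[of k] by (intro mult_right_mono) auto
    qed (use x y g in auto)
    ultimately have "cmod (ip y (g (N k))) \<ge> 1/2 * (1/3)^k * ip_norm ip (g (N k))" using big[of k] by linarith
    moreover have "1/2 * (1/3)^k * ip_norm ip (g (N k)) \<ge> 1/2 * (1/3)^k * 4^k" 
      using N[of k] by (intro mult_left_mono) auto
    moreover have "1/2 * (1/3)^k * 4^k = 1/2 * (4/3::real)^k" by (simp add: power_divide)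
    ultimately show ?thesis by linarith
  qed
  obtain B where B: "\<And>n. cmod (ip y (g n)) \<le> B" using bdd[OF y(1)] by blast
  obtain k where "2 * B < (4/3::real)^k" using real_arch_pow[of "4/3" "2 * B"] by auto
  then show False using large[of k] B[of "N k"] by linarith
qed

corollary (in hilbert_function_space) weak_limit_exists:
  assumes g: "\<And>n::nat. g n \<in> H" and lim: "\<And>f. f \<in> H \<Longrightarrow> (\<lambda>n. ip f (g n)) \<longlonglongrightarrow> \<phi> f"
  shows "\<exists>h\<in>H. \<forall>f\<in>H. \<phi> f = ip f h"
proof -
  have "\<exists>B. \<forall>n. cmod (ip f (g n)) \<le> B" if "f \<in> H" for f
  proof -
    have "Bseq (\<lambda>n. ip f (g n))" using lim[OF that] by (intro convergent_imp_Bseq convergentI)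
    then show ?thesis by (auto simp: Bseq_def)
  qed
  from uniform_boundedness[OF g this] obtain C where C: "\<And>n. ip_norm ip (g n) \<le> C" by blast
  show ?thesis
  proof (rule Riesz_representation)
    show "\<phi> (e + f) = \<phi> e + \<phi> f" if "e \<in> H" "f \<in> H" for e f
    proof (rule LIMSEQ_unique[OF lim[OF add_mem[OF that]]])
      show "(\<lambda>n. ip (e + f) (g n)) \<longlonglongrightarrow> \<phi> e + \<phi> f"
        using tendsto_add[OF lim[OF that(1)] lim[OF that(2)]] that g by (simp add: ip_add)
    qed
    show "\<phi> (fun_scale c f) = c * \<phi> f" if "f \<in> H" for c f
    proof (rule LIMSEQ_unique[OF lim[OF scale_mem[OF that]]])
      show "(\<lambda>n. ip (fun_scale c f) (g n)) \<longlonglongrightarrow> c * \<phi> f"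
        using tendsto_mult_left[OF lim[OF that], of c] that g by (simp add: ip_scale)
    qed
    show "cmod (\<phi> f) \<le> C * ip_norm ip f" if "f \<in> H" for f
    proof (rule LIMSEQ_le_const2[OF tendsto_norm[OF lim[OF that]]], intro exI allI impI)
      fix n
      have "ip_norm ip f * ip_norm ip (g n) \<le> ip_norm ip f * C"
        using C[of n] norm_nonneg[OF that] by (rule mult_left_mono)
      then show "cmod (ip f (g n)) \<le> C * ip_norm ip f"
        using Cauchy_Schwarz[OF that g, of n] by (simp add: mult.commute)
    qed
  qed
qed

section \<open>Partial derivatives of holomorphic functions\<close>

definition cpartial :: "'n::finite \<Rightarrow> (complex ^ 'n \<Rightarrow> complex) \<Rightarrow> complex ^ 'n \<Rightarrow> complex" where
  "cpartial j f w = frechet_derivative f (at w) (axis j 1)"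

lemma cvec_expansion: "v = (\<Sum>k\<in>UNIV. v $ k *s axis k (1::complex))"
  by (simp add: vec_eq_iff axis_def if_distrib cong: if_cong)

lemma holomorphic_several_on_has_derivative:
  assumes "holomorphic_several_on f \<Omega>" "z \<in> \<Omega>"
  shows "(f has_derivative (\<lambda>v. \<Sum>k\<in>UNIV. v $ k * cpartial k f z)) (at z)"
proof -
  obtain L where L: "(f has_derivative L) (at z)" "\<And>c v. L (c *s v) = c * L v"
    using assms unfolding holomorphic_several_on_def by blast
  interpret L: bounded_linear L using L(1) by (rule has_derivative_bounded_linear)
  have cp: "cpartial k f z = L (axis k 1)" for k
    using frechet_derivative_at[OF L(1)] by (simp add: cpartial_def)
  have "L v = (\<Sum>k\<in>UNIV. v $ k * cpartial k f z)" for v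
    by (subst cvec_expansion[of v], subst L.sum) (simp add: L(2) cp)
  then have "L = (\<lambda>v. \<Sum>k\<in>UNIV. v $ k * cpartial k f z)" by blast
  then show ?thesis using L(1) by simp
qed

lemma holomorphic_several_onI:
  assumes "\<And>z. z \<in> \<Omega> \<Longrightarrow> \<exists>a. (f has_derivative (\<lambda>v. \<Sum>k\<in>UNIV. v $ k * a k)) (at z)"
  shows "holomorphic_several_on f \<Omega>"
  unfolding holomorphic_several_on_def
proof
  fix z assume "z \<in> \<Omega>"
  then obtain a where a: "(f has_derivative (\<lambda>v. \<Sum>k\<in>UNIV. v $ k * a k)) (at z)" using assms by blast
  show "\<exists>L. (f has_derivative L) (at z) \<and> (\<forall>c v. L (c *s v) = c * L v)"
    by (rule exI, rule conjI, rule a) (simp add: sum_distrib_left mult.assoc)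
qed

lemma holomorphic_several_on_imp_continuous_on:
  assumes "holomorphic_several_on f \<Omega>" shows "continuous_on \<Omega> f"
  using holomorphic_several_on_has_derivative[OF assms]
  by (intro continuous_at_imp_continuous_on ballI) (rule has_derivative_continuous)

lemma cpartial_eqI:
  assumes "(f has_derivative (\<lambda>v. \<Sum>k\<in>UNIV. v $ k * a k)) (at z)"
  shows "cpartial j f z = a j"
  by (simp add: cpartial_def frechet_derivative_at[OF assms, symmetric] axis_def if_distrib if_distribR cong: if_cong)

lemma frechet_derivative_cong_open:
  assumes "open \<Omega>" "z \<in> \<Omega>" "\<And>w. w \<in> \<Omega> \<Longrightarrow> f w = g w"
  shows "frechet_derivative f (at z) = frechet_derivative g (at z)"
proof -
  have "(f has_derivative L) (at z) = (g has_derivative L) (at z)" for L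
    using has_derivative_transform_within_open[of f L z UNIV \<Omega> g] 
      has_derivative_transform_within_open[of g L z UNIV \<Omega> f] assms by auto
  then show ?thesis by (simp add: frechet_derivative_def)
qed

lemma norm_axis_complex: "norm (axis j (c::complex)) = norm c"
proof -
  have "(\<Sum>i\<in>UNIV. (norm (axis j c $ i))\<^sup>2) = (\<Sum>i\<in>UNIV. if i = j then (norm c)\<^sup>2 else 0)"
    by (rule sum.cong) (auto simp: axis_def)
  then show ?thesis by (simp add: norm_vec_def L2_set_def)
qed

lemma bounded_linear_axis: "bounded_linear (axis j :: complex \<Rightarrow> complex ^ 'n::finite)"
  by (rule bounded_linear_intro[where K=1]) (simp_all add: norm_axis_complex, auto simp: axis_def vec_eq_iff)

lemma has_field_derivative_along_axis:
  assumes "holomorphic_several_on f \<Omega>" "z + axis j \<zeta> \<in> \<Omega>"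
  shows "((\<lambda>\<zeta>. f (z + axis j \<zeta>)) has_field_derivative cpartial j f (z + axis j \<zeta>)) (at \<zeta>)"
proof -
  have ax: "((\<lambda>\<zeta>. z + axis j \<zeta>) has_derivative axis j) (at \<zeta>)"
    using has_derivative_add[OF has_derivative_const bounded_linear_imp_has_derivative[OF bounded_linear_axis]]
    by simp
  have "((f \<circ> (\<lambda>\<zeta>. z + axis j \<zeta>)) has_derivative
      (\<lambda>v. \<Sum>k\<in>UNIV. v $ k * cpartial k f (z + axis j \<zeta>)) \<circ> axis j) (at \<zeta>)"
    by (rule diff_chain_at[OF ax holomorphic_several_on_has_derivative[OF assms]])
  moreover have "(\<lambda>v. \<Sum>k\<in>UNIV. v $ k * cpartial k f (z + axis j \<zeta>)) \<circ> axis j = (*) (cpartial j f (z + axis j \<zeta>))"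
    by (rule ext) (simp add: axis_def if_distrib if_distribR cong: if_cong)
  ultimately show ?thesis by (simp add: has_field_derivative_def o_def)
qed

text \<open>
  Cauchy's formula for the derivative, in the \<open>j\<close>-th variable, as an integral over \<open>[0, 1]\<close>.  The
  weight \<open>h\<close> does not depend on \<open>z\<close> or \<open>j\<close>, so regularity of the partial derivatives in \<open>z\<close> is regularity
  of an integral in a parameter.
\<close>

lemma cpartial_circle_integral:
  fixes z0 :: "complex ^ 'n::finite" and r :: real
  assumes hol: "holomorphic_several_on f \<Omega>" and r: "0 < r" and sub: "ball z0 (2 * r) \<subseteq> \<Omega>"
  obtains h :: "real \<Rightarrow> complex" where "continuous_on {0..1} h"
    and "\<And>z j. z \<in> ball z0 r \<Longrightarrow>
      ((\<lambda>t. f (z + axis j (circlepath 0 r t)) * h t) has_integral cpartial j f z) {0..1}"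
proof
  \<comment> \<open>The weight \<open>\<gamma>' / (2 \<pi> \<i> \<gamma>\<^sup>2)\<close> of Cauchy's formula simplifies to \<open>1 / \<gamma>\<close> on a circle around \<open>0\<close>.\<close>
  define h where "h t = vector_derivative (circlepath 0 r) (at t) / (circlepath 0 r t)\<^sup>2 / (2 * pi * \<i>)" for t
  have nz: "circlepath 0 r t \<noteq> 0" for t using r by (simp add: circlepath)
  have h: "h t = 1 / circlepath 0 r t" for t
    using nz[of t] by (simp add: h_def vector_derivative_circlepath, simp add: circlepath power2_eq_square)
  have "continuous_on {0..1} (\<lambda>t. 1 / circlepath 0 r t)" 
    using path_circlepath[of 0 r] nz by (intro continuous_on_divide continuous_on_const) (auto simp: path_def)
  then show "continuous_on {0..1} h" by (simp add: h)
  fix z j assume z: "z \<in> ball z0 r"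
  have in_Om: "z + axis j \<zeta> \<in> \<Omega>" if "\<zeta> \<in> cball 0 r" for \<zeta>
  proof -
    have "dist z0 (z + axis j \<zeta>) \<le> dist z0 z + norm (axis j \<zeta>)"
      by (simp add: dist_norm) (metis diff_diff_add norm_triangle_ineq4)
    then show ?thesis using z that sub by (auto simp: norm_axis_complex subset_eq)
  qed
  let ?F = "\<lambda>\<zeta>. f (z + axis j \<zeta>)"
  have der: "(?F has_field_derivative cpartial j f (z + axis j \<zeta>)) (at \<zeta>)" if "\<zeta> \<in> cball 0 r" for \<zeta>
    by (rule has_field_derivative_along_axis[OF hol in_Om[OF that]])
  have "continuous_on (cball 0 r) ?F"
    using der by (intro continuous_at_imp_continuous_on ballI) (rule DERIV_isCont)
  moreover have "?F holomorphic_on ball 0 r"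
    unfolding holomorphic_on_open[OF open_ball] by (intro ballI exI, rule der) simp
  ultimately have "((\<lambda>u. ?F u / (u - 0) ^ Suc 1) has_contour_integral
      (2 * pi * \<i>) / fact 1 * (deriv ^^ 1) ?F 0) (circlepath 0 r)"
    using r by (intro Cauchy_has_contour_integral_higher_derivative_circlepath) auto
  moreover have "deriv ?F 0 = cpartial j f z"
    using DERIV_imp_deriv[OF der[of 0]] r by (simp add: axis_eq_0_iff[THEN iffD2])
  ultimately have "((\<lambda>t. ?F (circlepath 0 r t) / (circlepath 0 r t)\<^sup>2 * vector_derivative (circlepath 0 r) (at t))
      has_integral (2 * pi * \<i>) * cpartial j f z) {0..1}"
    by (simp add: has_contour_integral power2_eq_square)
  from has_integral_mult_right[OF this, of "1 / (2 * pi * \<i>)"]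
  show "((\<lambda>t. f (z + axis j (circlepath 0 r t)) * h t) has_integral cpartial j f z) {0..1}"
    by (simp add: h_def mult_ac)
qed

lemma continuous_on_compose_snd:
  "continuous_on T h \<Longrightarrow> continuous_on (S \<times> T) (\<lambda>x. h (snd x))"
  by (rule continuous_on_compose2) (auto intro: continuous_on_snd continuous_on_id)

lemma continuous_on_section:
  "continuous_on (S \<times> T) (\<lambda>(x, t). g x t) \<Longrightarrow> x \<in> S \<Longrightarrow> continuous_on T (g x)"
  by (rule continuous_on_compose2[of "S \<times> T" "\<lambda>(x, t). g x t" T "Pair x", unfolded prod.case])
    (auto intro!: continuous_intros)

lemma continuous_on_add_axis_circle:
  fixes f :: "complex ^ 'n::finite \<Rightarrow> 'b::topological_space"
  assumes f: "continuous_on \<Omega> f" and r: "0 < r" and sub: "ball z0 (2 * r) \<subseteq> \<Omega>"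
  shows "continuous_on (ball z0 r \<times> {0..1}) (\<lambda>(z, t). f (z + axis j (circlepath 0 r t)))"
  unfolding case_prod_beta
proof (rule continuous_on_compose2[OF f])
  have "continuous_on UNIV (circlepath 0 r)"
    unfolding circlepath_def part_circlepath_def by (auto intro!: continuous_intros simp: linepath_def)
  then have "continuous_on (ball z0 r \<times> {0..1}) (\<lambda>x. circlepath 0 r (snd x))"
    by (rule continuous_on_compose2) (auto intro: continuous_on_snd continuous_on_id)
  then show "continuous_on (ball z0 r \<times> {0..1}) (\<lambda>x. fst x + axis j (circlepath 0 r (snd x)))"
    by (intro continuous_on_add continuous_on_fst continuous_on_id bounded_linear.continuous_on[OF bounded_linear_axis])
  show "(\<lambda>x. fst x + axis j (circlepath 0 r (snd x))) ` (ball z0 r \<times> {0..1}) \<subseteq> \<Omega>"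
  proof clarsimp
    fix z :: "complex ^ 'n" and t :: real assume "dist z0 z < r"
    moreover have "cmod (circlepath 0 r t) = r" using r by (simp add: circlepath norm_mult)
    moreover have "dist z0 (z + axis j (circlepath 0 r t)) \<le> dist z0 z + norm (axis j (circlepath 0 r t))"
      by (simp add: dist_norm) (metis diff_diff_add norm_triangle_ineq4)
    ultimately show "z + axis j (circlepath 0 r t) \<in> \<Omega>" using sub by (auto simp: norm_axis_complex subset_eq)
  qed
qed

lemma open_imp_double_ball:
  assumes "open \<Omega>" "(z0 :: 'a::metric_space) \<in> \<Omega>" obtains r where "0 < r" "ball z0 (2 * r) \<subseteq> \<Omega>"
proof -
  obtain e where "0 < e" "ball z0 e \<subseteq> \<Omega>" using assms by (auto simp: open_contains_ball)
  then show thesis using that[of "e/2"] by simp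
qed

text \<open>
  Differentiability at each point does not give continuous partial derivatives directly.  By Cauchy's formula
  continuity of \<open>f\<close> itself suffices; the result is what permits differentiation under the integral below.
\<close>

lemma continuous_on_cpartial:
  assumes "open \<Omega>" "holomorphic_several_on f \<Omega>"
  shows "continuous_on \<Omega> (cpartial j f)"
proof (intro continuous_at_imp_continuous_on ballI)
  fix z0 assume "z0 \<in> \<Omega>"
  then obtain r where r: "0 < r" "ball z0 (2 * r) \<subseteq> \<Omega>" using open_imp_double_ball assms(1) by metis
  obtain h where h: "continuous_on {0..1} h" and int: "\<And>z j. z \<in> ball z0 r \<Longrightarrow>
      ((\<lambda>t. f (z + axis j (circlepath 0 r t)) * h t) has_integral cpartial j f z) {0..1}"
    using cpartial_circle_integral[OF assms(2) r] by blast
  have "continuous_on (ball z0 r \<times> cbox 0 1) (\<lambda>(z, t). f (z + axis j (circlepath 0 r t)) * h t)"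
    using continuous_on_add_axis_circle[OF holomorphic_several_on_imp_continuous_on[OF assms(2)] r, of j]
    unfolding case_prod_beta box_real by (intro continuous_on_mult continuous_on_compose_snd[OF h])
  then have "continuous_on (ball z0 r) (\<lambda>z. integral (cbox 0 1) (\<lambda>t. f (z + axis j (circlepath 0 r t)) * h t))"
    by (rule integral_continuous_on_param)
  moreover have "integral (cbox 0 1) (\<lambda>t. f (z + axis j (circlepath 0 r t)) * h t) = cpartial j f z"
    if "z \<in> ball z0 r" for z
    using int[OF that, of j] by (simp add: integral_unique)
  ultimately have "continuous_on (ball z0 r) (cpartial j f)"
    by (rule continuous_on_eq)
  then show "isCont (cpartial j f) z0" using r(1) by (simp add: continuous_on_eq_continuous_at)
qed

text \<open>
  Differentiation of Cauchy's formula under the integral.  The derivative of the integrand with respect to \<open>z\<close> is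
  complex linear, hence so is its integral.
\<close>

theorem holomorphic_several_on_cpartial:
  fixes f :: "complex ^ 'n::finite \<Rightarrow> complex"
  assumes op: "open \<Omega>" and hol: "holomorphic_several_on f \<Omega>"
  shows "holomorphic_several_on (cpartial j f) \<Omega>"
proof (rule holomorphic_several_onI)
  fix z0 assume z0: "z0 \<in> \<Omega>"
  then obtain r where r: "0 < r" "ball z0 (2 * r) \<subseteq> \<Omega>" using open_imp_double_ball op by metis
  let ?U = "ball z0 r" and ?p = "\<lambda>x t. x + axis j (circlepath 0 r t)"
  obtain h where h: "continuous_on {0..1} h" and int: "\<And>z j. z \<in> ?U \<Longrightarrow>
      ((\<lambda>t. f (z + axis j (circlepath 0 r t)) * h t) has_integral cpartial j f z) {0..1}"
    using cpartial_circle_integral[OF hol r] by blast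
  define P :: "'n \<Rightarrow> (complex ^ 'n) \<Rightarrow>\<^sub>L complex" where "P k = Blinfun (\<lambda>v. v $ k)" for k
  have P: "blinfun_apply (P k) v = v $ k" for k v
    unfolding P_def by (subst bounded_linear_Blinfun_apply) (auto intro: bounded_linear_vec_nth)
  define D where "D x t = (\<Sum>k\<in>UNIV. blinfun_mult_right (cpartial k f (?p x t) * h t) o\<^sub>L P k)" for x t
  have D_apply: "blinfun_apply (D x t) = (\<lambda>v. (\<Sum>k\<in>UNIV. v $ k * cpartial k f (?p x t)) * h t)" for x t
    by (rule ext) (simp add: D_def blinfun.sum_left P sum_distrib_left sum_distrib_right mult_ac)
  have in_Om: "?p x t \<in> \<Omega>" if "x \<in> ?U" "t \<in> {0..1}" for x t
  proof -
    have "dist z0 (?p x t) \<le> dist z0 x + norm (axis j (circlepath 0 r t))"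
      by (simp add: dist_norm) (metis diff_diff_add norm_triangle_ineq4)
    moreover have "cmod (circlepath 0 r t) = r" using r by (simp add: circlepath norm_mult)
    ultimately show ?thesis using r that by (auto simp: norm_axis_complex subset_eq)
  qed
  have cont: "continuous_on (?U \<times> {0..1}) (\<lambda>(x, t). g (?p x t) * h t)" if "continuous_on \<Omega> g" for g
    using continuous_on_add_axis_circle[OF that r, of j]
    unfolding case_prod_beta by (intro continuous_on_mult continuous_on_compose_snd[OF h])
  have D_cont: "continuous_on (?U \<times> {0..1}) (\<lambda>(x, t). D x t)"
    using cont[OF continuous_on_cpartial[OF op hol]]
    unfolding D_def case_prod_beta
    by (intro continuous_on_sum bounded_bilinear.continuous_on[OF bounded_bilinear_blinfun_compose]
        bounded_linear.continuous_on[OF bounded_linear_blinfun_mult_right] continuous_on_const) auto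
  have "((\<lambda>x. integral (cbox 0 1) (\<lambda>t. f (?p x t) * h t)) has_derivative
      blinfun_apply (integral (cbox 0 1) (D z0))) (at z0 within ?U)"
  proof (rule leibniz_rule)
    fix x t assume x: "x \<in> ?U" and t: "t \<in> cbox 0 (1::real)"
    have "((\<lambda>x. ?p x t) has_derivative (\<lambda>v. v)) (at x within ?U)"
      using has_derivative_add[OF has_derivative_ident has_derivative_const] by simp
    from diff_chain_within[OF this has_derivative_at_withinI[OF holomorphic_several_on_has_derivative[OF hol in_Om]]] x t
    have "((\<lambda>x. f (?p x t)) has_derivative (\<lambda>v. \<Sum>k\<in>UNIV. v $ k * cpartial k f (?p x t))) (at x within ?U)"
      by (simp add: o_def)
    from has_derivative_mult_left[OF this, of "h t"]
    show "((\<lambda>x. f (?p x t) * h t) has_derivative blinfun_apply (D x t)) (at x within ?U)"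
      unfolding D_apply .
  next
    show "(\<lambda>t. f (?p x t) * h t) integrable_on cbox 0 1" if "x \<in> ?U" for x
      using int[OF that] by (auto simp: integrable_on_def)
    show "continuous_on (?U \<times> cbox 0 1) (\<lambda>(x, t). D x t)" using D_cont by simp
  qed (use r in auto)
  then have "((\<lambda>x. integral (cbox 0 1) (\<lambda>t. f (?p x t) * h t)) has_derivative
      blinfun_apply (integral (cbox 0 1) (D z0))) (at z0)"
    using r(1) by (simp add: at_within_open[of z0 ?U])
  then have der: "(cpartial j f has_derivative blinfun_apply (integral (cbox 0 1) (D z0))) (at z0)"
    by (rule has_derivative_transform_within_open[where s="?U"]) (use r(1) int in \<open>auto simp: integral_unique\<close>)
  have coef_int: "(\<lambda>t. cpartial k f (?p z0 t) * h t) integrable_on cbox 0 1" for k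
    using continuous_on_section[OF cont[OF continuous_on_cpartial[OF op hol, of k]], of z0] r(1)
    by (intro integrable_continuous) simp
  have "D z0 integrable_on cbox 0 1"
    using continuous_on_section[OF D_cont, of z0] r(1) by (intro integrable_continuous) simp
  then have "blinfun_apply (integral (cbox 0 1) (D z0)) v =
      (\<Sum>k\<in>UNIV. v $ k * integral (cbox 0 1) (\<lambda>t. cpartial k f (?p z0 t) * h t))" for v
    using coef_int
    by (simp add: blinfun_apply_integral D_apply sum_distrib_right mult.assoc integral_sum integrable_on_mult_right del: box_real)
  then have eq: "blinfun_apply (integral (cbox 0 1) (D z0)) =
      (\<lambda>v. \<Sum>k\<in>UNIV. v $ k * integral (cbox 0 1) (\<lambda>t. cpartial k f (?p z0 t) * h t))"
    by (rule ext)
  show "\<exists>a. (cpartial j f has_derivative (\<lambda>v. \<Sum>k\<in>UNIV. v $ k * a k)) (at z0)"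
    by (rule exI[of _ "\<lambda>k. integral (cbox 0 1) (\<lambda>t. cpartial k f (?p z0 t) * h t)"], rule der[unfolded eq])
qed

section \<open>Iterated derivatives and the reproducing kernel\<close>

definition cpartial_multi ::
  "('n::finite \<Rightarrow>\<^sub>0 nat) \<Rightarrow> (complex ^ 'n \<Rightarrow> complex) \<Rightarrow> complex ^ 'n \<Rightarrow> complex" where
  "cpartial_multi \<alpha> f =
    foldr (\<lambda>j. cpartial j ^^ Poly_Mapping.lookup \<alpha> j) (SOME js. distinct js \<and> set js = UNIV) f"

text \<open>
  Both iterated operators use the same enumeration of the variables, so they can be compared one derivative at a
  time.
\<close>

lemma dbar_cpartial_multi_induct:
  assumes base: "Q (\<lambda>g. g) (\<lambda>f. f)"
    and step: "\<And>j D D'. Q D D' \<Longrightarrow> Q (\<lambda>g. dbar j (D g)) (\<lambda>f. cpartial j (D' f))"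
  shows "Q (dbar_multi \<alpha>) (cpartial_multi \<alpha>)"
proof -
  have pow: "Q (\<lambda>g. (dbar j ^^ n) (D g)) (\<lambda>f. (cpartial j ^^ n) (D' f))" if "Q D D'" for j n D D'
    by (induction n) (use that step in auto)
  have "Q (foldr (\<lambda>j. dbar j ^^ Poly_Mapping.lookup \<alpha> j) js) (foldr (\<lambda>j. cpartial j ^^ Poly_Mapping.lookup \<alpha> j) js)" for js
  proof (induction js)
    case Nil then show ?case using base by (simp add: id_def)
  next
    case (Cons j js) then show ?case using pow by (simp add: o_def)
  qed
  then show ?thesis unfolding dbar_multi_def[abs_def] cpartial_multi_def[abs_def] .
qed

text \<open>
  Conjugation exchanges the two Wirtinger derivatives, and the one with respect to \<open>w\<^sub>j\<close> is the
  complex partial derivative of a holomorphic function.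
\<close>

lemma dbar_cnj:
  assumes op: "open \<Omega>" and hol: "holomorphic_several_on f \<Omega>" and w: "w \<in> \<Omega>"
    and g: "\<And>w. w \<in> \<Omega> \<Longrightarrow> g w = cnj (f w)"
  shows "dbar j g w = cnj (cpartial j f w)"
proof -
  let ?L = "\<lambda>v. \<Sum>k\<in>UNIV. v $ k * cpartial k f w"
  have "((\<lambda>z. cnj (f z)) has_derivative (\<lambda>v. cnj (?L v))) (at w)"
    by (intro has_derivative_cnj holomorphic_several_on_has_derivative[OF hol w])
  then have "frechet_derivative g (at w) = (\<lambda>v. cnj (?L v))"
    using frechet_derivative_at[symmetric] frechet_derivative_cong_open[OF op w g] by simp
  then have "frechet_derivative g (at w) v = cnj (?L v)" for v by (rule fun_cong)
  moreover have "?L (axis j c) = c * cpartial j f w" for c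
    by (simp add: axis_def if_distrib if_distribR cong: if_cong)
  ultimately have "frechet_derivative g (at w) (axis j c) = cnj (c * cpartial j f w)" for c by metis
  then have "dbar j g w = (cnj (cpartial j f w) + \<i> * cnj (\<i> * cpartial j f w)) / 2"
    unfolding dbar_def by simp
  also have "\<dots> = cnj (cpartial j f w)" by (simp add: algebra_simps flip: mult.assoc)
  finally show ?thesis .
qed

lemma dbar_multi_cnj:
  fixes f g :: "complex ^ 'n::finite \<Rightarrow> complex"
  assumes op: "open \<Omega>" and hol: "holomorphic_several_on f \<Omega>" and w: "w \<in> \<Omega>"
    and g: "\<And>w. w \<in> \<Omega> \<Longrightarrow> g w = cnj (f w)"
  shows "dbar_multi \<alpha> g w = cnj (cpartial_multi \<alpha> f w)"
proof -
  define Q where "Q D D' \<longleftrightarrow> (\<forall>f g. holomorphic_several_on f \<Omega> \<and> (\<forall>w\<in>\<Omega>. g w = cnj (f w)) \<longrightarrow>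
      holomorphic_several_on (D' f) \<Omega> \<and> (\<forall>w\<in>\<Omega>. D g w = cnj (D' f w)))"
    for D D' :: "(complex ^ 'n \<Rightarrow> complex) \<Rightarrow> complex ^ 'n \<Rightarrow> complex"
  have "Q (dbar_multi \<alpha>) (cpartial_multi \<alpha>)"
  proof (rule dbar_cpartial_multi_induct)
    show "Q (\<lambda>g. g) (\<lambda>f. f)" by (simp add: Q_def)
    fix j D D' assume IH: "Q D D'"
    show "Q (\<lambda>g. dbar j (D g)) (\<lambda>f. cpartial j (D' f))"
      unfolding Q_def
    proof (intro allI impI conjI ballI)
      fix f g w assume "holomorphic_several_on f \<Omega> \<and> (\<forall>w\<in>\<Omega>. g w = cnj (f w))"
      then have fg: "holomorphic_several_on (D' f) \<Omega>" "\<And>w. w \<in> \<Omega> \<Longrightarrow> D g w = cnj (D' f w)"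
        using IH unfolding Q_def by blast+
      show "holomorphic_several_on (cpartial j (D' f)) \<Omega>"
        by (rule holomorphic_several_on_cpartial[OF op fg(1)])
      show "dbar j (D g) w = cnj (cpartial j (D' f) w)" if "w \<in> \<Omega>"
        by (rule dbar_cnj[OF op fg(1) that fg(2)])
    qed
  qed
  then show ?thesis unfolding Q_def using hol w g by blast
qed

lemma cpartial_multi_cong_open:
  fixes f g :: "complex ^ 'n::finite \<Rightarrow> complex"
  assumes op: "open \<Omega>" and w: "w \<in> \<Omega>" and fg: "\<And>w. w \<in> \<Omega> \<Longrightarrow> f w = g w"
  shows "cpartial_multi \<alpha> f w = cpartial_multi \<alpha> g w"
proof -
  define Q where "Q D D' \<longleftrightarrow> (\<forall>f g. (\<forall>w\<in>\<Omega>. f w = g w) \<longrightarrow> (\<forall>w\<in>\<Omega>. D' f w = D' g w))"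
    for D D' :: "(complex ^ 'n \<Rightarrow> complex) \<Rightarrow> complex ^ 'n \<Rightarrow> complex"
  have "Q (dbar_multi \<alpha>) (cpartial_multi \<alpha>)"
  proof (rule dbar_cpartial_multi_induct)
    show "Q (\<lambda>g. g) (\<lambda>f. f)" by (simp add: Q_def)
    fix j D D' assume IH: "Q D D'"
    show "Q (\<lambda>g. dbar j (D g)) (\<lambda>f. cpartial j (D' f))"
      unfolding Q_def
    proof (intro allI impI ballI)
      fix f g :: "complex ^ 'n \<Rightarrow> complex" and w
      assume "\<forall>w\<in>\<Omega>. f w = g w" and w: "w \<in> \<Omega>"
      then have "D' f w = D' g w" if "w \<in> \<Omega>" for w using IH that unfolding Q_def by blast
      then show "cpartial j (D' f) w = cpartial j (D' g) w"
        unfolding cpartial_def using frechet_derivative_cong_open[OF op w] by metis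
    qed
  qed
  then show ?thesis unfolding Q_def using w fg by blast
qed

text \<open>
  For \<open>f \<in> H\<close> the difference quotients of \<open>D f\<close> at \<open>w\<close> are pairings with difference quotients of the representing
  vectors, and they converge because \<open>D f\<close> is holomorphic; so these vectors converge weakly, and their weak
  limit represents the derivative.
\<close>

lemma (in hilbert_function_space) cpartial_representable:
  assumes op: "open \<Omega>"
    and hol: "\<And>f. f \<in> H \<Longrightarrow> holomorphic_several_on (D f) \<Omega>"
    and rep: "\<And>u. u \<in> \<Omega> \<Longrightarrow> \<exists>E\<in>H. \<forall>f\<in>H. D f u = ip f E"
    and w: "w \<in> \<Omega>"
  shows "\<exists>E\<in>H. \<forall>f\<in>H. cpartial j (D f) w = ip f E"
proof -
  have "\<forall>u. \<exists>E. E \<in> H \<and> (u \<in> \<Omega> \<longrightarrow> (\<forall>f\<in>H. D f u = ip f E))" using rep zero_mem by blast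
  then obtain E where E: "\<And>u. E u \<in> H" and E_rep: "\<And>u f. u \<in> \<Omega> \<Longrightarrow> f \<in> H \<Longrightarrow> D f u = ip f (E u)"
    by metis
  \<comment> \<open>Off \<open>\<Omega>\<close> the values of \<open>E\<close> are arbitrary elements of \<open>H\<close>; the points \<open>e n\<close> below are eventually in \<open>\<Omega>\<close>.\<close>
  define s where "s n = inverse (of_nat (Suc n) :: complex)" for n
  have s: "s \<longlonglongrightarrow> 0" "\<And>n. s n \<noteq> 0"
    using tendsto_of_real[OF LIMSEQ_inverse_real_of_nat, where 'a=complex]
    by (simp_all add: s_def[abs_def] of_nat_neq_0 del: of_nat_Suc)
  define e where "e n = w + axis j (s n)" for n
  have "e \<longlonglongrightarrow> w + axis j 0"
    unfolding e_def[abs_def] by (intro tendsto_add tendsto_const bounded_linear.tendsto[OF bounded_linear_axis] s)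
  then have e: "e \<longlonglongrightarrow> w" by (simp add: axis_eq_0_iff[THEN iffD2])
  have ev: "\<forall>\<^sub>F n in sequentially. e n \<in> \<Omega>" using topological_tendstoD[OF e op w] .
  define g where "g n = fun_scale (cnj (1 / s n)) (E (e n) - E w)" for n
  have g: "g n \<in> H" for n using E by (auto simp: g_def)
  show ?thesis
  proof (rule weak_limit_exists[where g=g, OF g])
    fix f assume f: "f \<in> H"
    have ax0: "w + axis j 0 = w" by (simp add: axis_eq_0_iff[THEN iffD2])
    have "((\<lambda>\<zeta>. D f (w + axis j \<zeta>)) has_field_derivative cpartial j (D f) (w + axis j 0)) (at 0)"
      by (rule has_field_derivative_along_axis[OF hol[OF f]]) (simp add: ax0 w)
    then have "((\<lambda>h. (D f (w + axis j h) - D f w) / h) \<longlongrightarrow> cpartial j (D f) w) (at 0)"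
      by (simp add: DERIV_def ax0)
    moreover have "filterlim s (at 0) sequentially" using s by (simp add: filterlim_at)
    ultimately have "(\<lambda>n. (D f (w + axis j (s n)) - D f w) / s n) \<longlonglongrightarrow> cpartial j (D f) w"
      by (rule filterlim_compose)
    moreover have "\<forall>\<^sub>F n in sequentially. (D f (w + axis j (s n)) - D f w) / s n = ip f (g n)"
      using ev
    proof eventually_elim
      case (elim n)
      then show ?case using E f w E_rep[OF elim f] E_rep[OF w f]
        by (simp add: g_def ip_scale_right ip_diff_right diff_mem e_def)
    qed
    ultimately show "(\<lambda>n. ip f (g n)) \<longlonglongrightarrow> cpartial j (D f) w" by (rule Lim_transform_eventually)
  qed
qed

lemma (in hilbert_function_space) cpartial_multi_representable:
  assumes op: "open \<Omega>" and ker: "reproducing_kernel \<Omega> H ip K" and w: "w \<in> \<Omega>"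
  shows "\<exists>E\<in>H. \<forall>f\<in>H. cpartial_multi \<alpha> f w = ip f E"
proof -
  define Q where "Q D D' \<longleftrightarrow> (\<forall>f\<in>H. holomorphic_several_on (D' f) \<Omega>) \<and> (\<forall>w\<in>\<Omega>. \<exists>E\<in>H. \<forall>f\<in>H. D' f w = ip f E)"
    for D D' :: "(complex ^ 'n \<Rightarrow> complex) \<Rightarrow> complex ^ 'n \<Rightarrow> complex"
  have "Q (dbar_multi \<alpha>) (cpartial_multi \<alpha>)"
  proof (rule dbar_cpartial_multi_induct)
    have "\<exists>E\<in>H. \<forall>f\<in>H. f w = ip f E" if "w \<in> \<Omega>" for w
      using ker that unfolding reproducing_kernel_def by metis
    then show "Q (\<lambda>g. g) (\<lambda>f. f)" using holomorphic unfolding Q_def by blast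
    fix j D D' assume "Q D D'"
    then show "Q (\<lambda>g. dbar j (D g)) (\<lambda>f. cpartial j (D' f))"
      unfolding Q_def using holomorphic_several_on_cpartial[OF op] cpartial_representable[OF op, of D'] by simp
  qed
  then show ?thesis unfolding Q_def using w by blast
qed

text \<open>
  The vector \<open>E\<close> that represents \<open>f \<mapsto> \<partial>\<^sup>\<alpha> f w\<close> has the value
  \<open>\<langle>E, K(\<cdot>, z)\<rangle> = cnj (\<partial>\<^sup>\<alpha> K(\<cdot>, z) w)\<close> at \<open>z\<close>, and \<open>K(z, \<cdot>)\<close> is the conjugate of the holomorphic function
  \<open>K(\<cdot>, z)\<close>; so \<open>E\<close> is the antiholomorphic derivative of the kernel.
\<close>

lemma (in hilbert_function_space) dbar_multi_kernel:
  assumes op: "open \<Omega>" and ker: "reproducing_kernel \<Omega> H ip K" and w: "w \<in> \<Omega>"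
  shows "(\<lambda>z. dbar_multi \<alpha> (\<lambda>u. K z u) w) \<in> H"
    and "f \<in> H \<Longrightarrow> ip f (\<lambda>z. dbar_multi \<alpha> (\<lambda>u. K z u) w) = cpartial_multi \<alpha> f w"
proof -
  obtain E where E: "E \<in> H" "\<And>f. f \<in> H \<Longrightarrow> cpartial_multi \<alpha> f w = ip f E"
    using cpartial_multi_representable[OF op ker w] by blast
  have K: "(\<lambda>z. K z u) \<in> H" "\<And>f. f \<in> H \<Longrightarrow> ip f (\<lambda>z. K z u) = f u" if "u \<in> \<Omega>" for u
    using ker that unfolding reproducing_kernel_def by blast+
  have "dbar_multi \<alpha> (\<lambda>u. K z u) w = E z" for z
  proof (cases "z \<in> \<Omega>")
    case True
    have "K z u = cnj (K u z)" if "u \<in> \<Omega>" for u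
      using ip_cnj[OF K(1)[OF True] K(1)[OF that]] K(2)[OF that K(1)[OF True]] K(2)[OF True K(1)[OF that]] by simp
    then have "dbar_multi \<alpha> (\<lambda>u. K z u) w = cnj (cpartial_multi \<alpha> (\<lambda>u. K u z) w)"
      by (intro dbar_multi_cnj[OF op holomorphic[OF K(1)[OF True]] w])
    also have "\<dots> = ip E (\<lambda>u. K u z)"
      using E K(1)[OF True] ip_cnj[of "\<lambda>u. K u z" E] by simp
    also have "\<dots> = E z" using K(2)[OF True E(1)] .
    finally show ?thesis .
  next
    case False
    have "K z u = cnj (0 u)" if "u \<in> \<Omega>" for u using zero_outside[OF K(1)[OF that] False] by simp
    then have "dbar_multi \<alpha> (\<lambda>u. K z u) w = cnj (cpartial_multi \<alpha> 0 w)"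
      by (intro dbar_multi_cnj[OF op holomorphic[OF zero_mem] w])
    also have "\<dots> = 0" unfolding E(2)[OF zero_mem] ip_zero_left[OF E(1)] by simp
    finally show ?thesis using zero_outside[OF E(1) False] by simp
  qed
  then have eq: "(\<lambda>z. dbar_multi \<alpha> (\<lambda>u. K z u) w) = E" by (rule ext)
  show "(\<lambda>z. dbar_multi \<alpha> (\<lambda>u. K z u) w) \<in> H" unfolding eq by (rule E)
  show "ip f (\<lambda>z. dbar_multi \<alpha> (\<lambda>u. K z u) w) = cpartial_multi \<alpha> f w" if "f \<in> H"
    unfolding eq using E(2)[OF that] by simp
qed

section \<open>Derivatives of polynomials at the origin\<close>

definition monomial_fun :: "('n::finite \<Rightarrow> nat) \<Rightarrow> complex ^ 'n \<Rightarrow> complex" where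
  "monomial_fun b z = (\<Prod>i\<in>UNIV. z $ i ^ b i)"

lemma has_derivative_monomial_fun:
  "(monomial_fun b has_derivative
    (\<lambda>v. \<Sum>k\<in>UNIV. v $ k * (of_nat (b k) * monomial_fun (b(k := b k - 1)) z))) (at z)"
proof -
  have "((\<lambda>z. \<Prod>i\<in>UNIV. z $ i ^ b i) has_derivative
      (\<lambda>v. \<Sum>k\<in>UNIV. (of_nat (b k) * (v $ k) * z $ k ^ (b k - 1)) * (\<Prod>i\<in>UNIV - {k}. z $ i ^ b i))) (at z)"
    by (intro has_derivative_prod has_derivative_power bounded_linear_imp_has_derivative bounded_linear_vec_nth)
  moreover have "monomial_fun (b(k := b k - 1)) z = z $ k ^ (b k - 1) * (\<Prod>i\<in>UNIV - {k}. z $ i ^ b i)" for k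
    unfolding monomial_fun_def by (subst prod.remove[of _ k]) auto
  ultimately show ?thesis by (simp add: monomial_fun_def[abs_def] mult_ac)
qed

lemma cpartial_monomial_sum:
  fixes b :: "'s \<Rightarrow> 'n::finite \<Rightarrow> nat"
  assumes "finite S"
  shows "cpartial j (\<lambda>z. \<Sum>s\<in>S. c s * monomial_fun (b s) z) =
    (\<lambda>z. \<Sum>s\<in>S. c s * of_nat (b s j) * monomial_fun ((b s)(j := b s j - 1)) z)"
proof
  fix z :: "complex ^ 'n"
  have der: "((\<lambda>z. \<Sum>s\<in>S. c s * monomial_fun (b s) z) has_derivative
      (\<lambda>v. \<Sum>s\<in>S. c s * (\<Sum>k\<in>UNIV. v $ k * (of_nat (b s k) * monomial_fun ((b s)(k := b s k - 1)) z)))) (at z)"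
    by (intro has_derivative_sum has_derivative_mult_right has_derivative_monomial_fun)
  have eq: "(\<Sum>s\<in>S. c s * (\<Sum>k\<in>UNIV. v $ k * (of_nat (b s k) * monomial_fun ((b s)(k := b s k - 1)) z))) =
      (\<Sum>k\<in>UNIV. v $ k * (\<Sum>s\<in>S. c s * of_nat (b s k) * monomial_fun ((b s)(k := b s k - 1)) z))" for v
    unfolding sum_distrib_left by (subst sum.swap) (simp add: mult_ac)
  show "cpartial j (\<lambda>z. \<Sum>s\<in>S. c s * monomial_fun (b s) z) z =
      (\<Sum>s\<in>S. c s * of_nat (b s j) * monomial_fun ((b s)(j := b s j - 1)) z)"
    by (rule cpartial_eqI[OF der[unfolded eq]])
qed

text \<open>
  The factors are falling factorials written with truncated subtraction: if \<open>b s j < n\<close>, the product contains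
  a zero factor, which makes the meaningless exponent harmless.
\<close>

lemma cpartial_power_monomial_sum:
  fixes b :: "'s \<Rightarrow> 'n::finite \<Rightarrow> nat"
  assumes "finite S"
  shows "(cpartial j ^^ n) (\<lambda>z. \<Sum>s\<in>S. c s * monomial_fun (b s) z) =
    (\<lambda>z. \<Sum>s\<in>S. c s * (\<Prod>l<n. of_nat (b s j - l)) * monomial_fun ((b s)(j := b s j - n)) z)"
proof (induction n)
  case (Suc n)
  have "(cpartial j ^^ Suc n) (\<lambda>z. \<Sum>s\<in>S. c s * monomial_fun (b s) z) =
      cpartial j (\<lambda>z. \<Sum>s\<in>S. c s * (\<Prod>l<n. of_nat (b s j - l)) * monomial_fun ((b s)(j := b s j - n)) z)"
    unfolding funpow.simps o_apply Suc ..
  also have "\<dots> = (\<lambda>z. \<Sum>s\<in>S. c s * (\<Prod>l<Suc n. of_nat (b s j - l)) * monomial_fun ((b s)(j := b s j - Suc n)) z)"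
    by (subst cpartial_monomial_sum[OF assms]) (simp add: mult_ac)
  finally show ?case .
qed simp

lemma cpartial_foldr_monomial_sum:
  fixes b :: "'s \<Rightarrow> 'n::finite \<Rightarrow> nat"
  assumes "finite S" "distinct js"
  shows "foldr (\<lambda>j. cpartial j ^^ a j) js (\<lambda>z. \<Sum>s\<in>S. c s * monomial_fun (b s) z) =
    (\<lambda>z. \<Sum>s\<in>S. c s * (\<Prod>j\<in>set js. \<Prod>l<a j. of_nat (b s j - l)) *
      monomial_fun (\<lambda>i. if i \<in> set js then b s i - a i else b s i) z)"
  using assms(2)
proof (induction js)
  case (Cons k js)
  have upd: "(\<lambda>i. if i \<in> set js then b s i - a i else b s i)(k := b s k - a k) =
      (\<lambda>i. if i \<in> set (k # js) then b s i - a i else b s i)" for s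
    by (auto simp: fun_eq_iff)
  have "foldr (\<lambda>j. cpartial j ^^ a j) (k # js) (\<lambda>z. \<Sum>s\<in>S. c s * monomial_fun (b s) z) =
      (cpartial k ^^ a k) (\<lambda>z. \<Sum>s\<in>S. c s * (\<Prod>j\<in>set js. \<Prod>l<a j. of_nat (b s j - l)) *
        monomial_fun (\<lambda>i. if i \<in> set js then b s i - a i else b s i) z)"
    using Cons by simp
  also have "\<dots> = (\<lambda>z. \<Sum>s\<in>S. c s * (\<Prod>j\<in>set js. \<Prod>l<a j. of_nat (b s j - l)) * (\<Prod>l<a k. of_nat (b s k - l)) *
        monomial_fun (\<lambda>i. if i \<in> set (k # js) then b s i - a i else b s i) z)"
    unfolding cpartial_power_monomial_sum[OF assms(1)] using Cons(2) by (simp add: upd[symmetric] del: set_simps)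
  finally show ?case using Cons(2) by (simp add: mult_ac)
qed simp

definition multi_fact :: "('n::finite \<Rightarrow>\<^sub>0 nat) \<Rightarrow> real" where
  "multi_fact \<alpha> = (\<Prod>i\<in>UNIV. fact (Poly_Mapping.lookup \<alpha> i))"

text \<open>
  At the origin only the monomial with exponent exactly \<open>\<alpha>\<close> survives: a smaller exponent in some variable is
  differentiated away, a larger one leaves a power of that variable.
\<close>

lemma cpartial_multi_poly_eval_0:
  "cpartial_multi \<alpha> (poly_eval p) 0 = Poly_Mapping.lookup p \<alpha> * of_real (multi_fact \<alpha>)"
proof -
  define js where "js = (SOME js :: 'a list. distinct js \<and> set js = UNIV)"
  have js: "distinct js" "set js = UNIV"
    using someI_ex[of "\<lambda>js :: 'a list. distinct js \<and> set js = UNIV"] finite_distinct_list[OF finite]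
    unfolding js_def by blast+
  let ?a = "Poly_Mapping.lookup \<alpha>" and ?b = "Poly_Mapping.lookup :: ('a \<Rightarrow>\<^sub>0 nat) \<Rightarrow> 'a \<Rightarrow> nat"
  have value_0: "(\<Prod>j\<in>UNIV. \<Prod>l<?a j. of_nat (?b \<beta> j - l)) * monomial_fun (\<lambda>i. ?b \<beta> i - ?a i) 0 =
      (if \<beta> = \<alpha> then of_real (multi_fact \<alpha>) else (0 :: complex))" for \<beta>
  proof (cases "\<beta> = \<alpha>")
    case True
    have "(\<Prod>l<n. of_nat (n - l)) = (fact n :: complex)" for n
      by (simp add: fact_prod_rev lessThan_atLeast0)
    then show ?thesis using True by (simp add: monomial_fun_def multi_fact_def)
  next
    case False
    then obtain i where i: "?b \<beta> i \<noteq> ?a i" using poly_mapping_eqI[of \<beta> \<alpha>] by auto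
    show ?thesis
    proof (cases "?b \<beta> i < ?a i")
      case True
      then have "(\<Prod>l<?a i. of_nat (?b \<beta> i - l)) = (0 :: complex)" by (intro prod_zero) auto
      then have "(\<Prod>j\<in>UNIV. \<Prod>l<?a j. of_nat (?b \<beta> j - l)) = (0 :: complex)"
        by (intro prod_zero[OF finite] bexI[of _ i]) auto
      then show ?thesis using False by simp
    next
      case 2: False
      then have "monomial_fun (\<lambda>i. ?b \<beta> i - ?a i) 0 = 0"
        unfolding monomial_fun_def using i by (intro prod_zero[OF finite] bexI[of _ i]) auto
      then show ?thesis using False by simp
    qed
  qed
  have "poly_eval p = (\<lambda>z. \<Sum>\<beta>\<in>Poly_Mapping.keys p. Poly_Mapping.lookup p \<beta> * monomial_fun (?b \<beta>) z)"
    by (simp add: fun_eq_iff poly_eval_def monomial_fun_def)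
  then have "cpartial_multi \<alpha> (poly_eval p) 0 = (\<Sum>\<beta>\<in>Poly_Mapping.keys p. Poly_Mapping.lookup p \<beta> *
      ((\<Prod>j\<in>UNIV. \<Prod>l<?a j. of_nat (?b \<beta> j - l)) * monomial_fun (\<lambda>i. ?b \<beta> i - ?a i) 0))"
    unfolding cpartial_multi_def js_def[symmetric]
    by (simp add: cpartial_foldr_monomial_sum js mult.assoc)
  also have "\<dots> = (\<Sum>\<beta>\<in>Poly_Mapping.keys p. if \<beta> = \<alpha> then Poly_Mapping.lookup p \<beta> * of_real (multi_fact \<alpha>) else 0)"
    unfolding value_0 by (simp add: if_distrib cong: if_cong)
  also have "\<dots> = Poly_Mapping.lookup p \<alpha> * of_real (multi_fact \<alpha>)"
    by (simp add: in_keys_iff)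
  finally show ?thesis .
qed

section \<open>Polynomials as a complex vector space\<close>

text \<open>
  The ideal structure of the polynomial ring is a module over the ring itself; scalar multiplication by constants
  gives it a second module structure, in which linear independence and projections make sense.
\<close>

definition poly_scale :: "complex \<Rightarrow> 'n::finite cpoly \<Rightarrow> 'n cpoly" where
  "poly_scale c p = Poly_Mapping.single 0 c * p"

lemma lookup_poly_scale [simp]: "Poly_Mapping.lookup (poly_scale c p) \<alpha> = c * Poly_Mapping.lookup p \<alpha>"
  unfolding poly_scale_def mult_map_scale_conv_mult [symmetric]
  by (simp add: Poly_Mapping.map.rep_eq when_def)

interpretation cpoly: vector_space poly_scale
  by (rule vector_space.intro)
    (simp_all add: poly_mapping_eq_iff fun_eq_iff lookup_add distrib_left distrib_right)

abbreviation pmonom :: "('n::finite \<Rightarrow>\<^sub>0 nat) \<Rightarrow> 'n cpoly" where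
  "pmonom \<alpha> \<equiv> Poly_Mapping.single \<alpha> 1"

lemma poly_scale_mult_right: "p * poly_scale c q = poly_scale c (p * q)"
  by (simp add: poly_scale_def mult.left_commute)

lemma pmonom_mult_pmonom: "pmonom \<alpha> * (pmonom \<beta> * p) = pmonom (\<alpha> + \<beta>) * p"
  by (simp add: mult_single flip: mult.assoc)

lemma poly_expansion: "p = (\<Sum>\<alpha>\<in>Poly_Mapping.keys p. poly_scale (Poly_Mapping.lookup p \<alpha>) (pmonom \<alpha>))"
proof (rule poly_mapping_eqI)
  fix \<beta>
  have "Poly_Mapping.lookup (\<Sum>\<alpha>\<in>Poly_Mapping.keys p. poly_scale (Poly_Mapping.lookup p \<alpha>) (pmonom \<alpha>)) \<beta> =
      (\<Sum>\<alpha>\<in>Poly_Mapping.keys p. if \<alpha> = \<beta> then Poly_Mapping.lookup p \<beta> else 0)"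
    unfolding lookup_sum by (intro sum.cong) (auto simp: lookup_single when_def)
  then show "Poly_Mapping.lookup p \<beta> =
      Poly_Mapping.lookup (\<Sum>\<alpha>\<in>Poly_Mapping.keys p. poly_scale (Poly_Mapping.lookup p \<alpha>) (pmonom \<alpha>)) \<beta>"
    by (simp add: in_keys_iff)
qed

lemma ideal_imp_cpoly_subspace: "ideal.subspace I \<Longrightarrow> cpoly.subspace I"
  unfolding cpoly.subspace_def ideal.subspace_def poly_scale_def by blast

text \<open>
  Multiplication by a polynomial is a combination of multiplications by monomials, so statements about ideals can be
  checked on monomials.
\<close>

lemma cpoly_subspace_imp_ideal:
  assumes "cpoly.subspace S" "\<And>\<alpha> p. p \<in> S \<Longrightarrow> pmonom \<alpha> * p \<in> S"
  shows "ideal.subspace S"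
  unfolding ideal.subspace_def
proof (intro conjI ballI allI)
  fix g p assume p: "p \<in> S"
  have "g * p = (\<Sum>\<alpha>\<in>Poly_Mapping.keys g. poly_scale (Poly_Mapping.lookup g \<alpha>) (pmonom \<alpha>)) * p"
    using poly_expansion[of g] by simp
  also have "\<dots> = (\<Sum>\<alpha>\<in>Poly_Mapping.keys g. poly_scale (Poly_Mapping.lookup g \<alpha>) (pmonom \<alpha> * p))"
    by (simp add: sum_distrib_right poly_scale_def mult.assoc)
  also have "\<dots> \<in> S"
    using assms p by (intro cpoly.subspace_sum cpoly.subspace_scale) auto
  finally show "g * p \<in> S" .
qed (use assms(1) in \<open>auto simp: cpoly.subspace_def\<close>)

definition homogeneous_of_degree :: "nat \<Rightarrow> 'n::finite cpoly \<Rightarrow> bool" where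
  "homogeneous_of_degree d p \<longleftrightarrow> (\<forall>\<alpha>\<in>Poly_Mapping.keys p. multi_degree \<alpha> = d)"

lemma subspace_homogeneous_of_degree: "cpoly.subspace {p. homogeneous_of_degree d p}"
  unfolding cpoly.subspace_def homogeneous_of_degree_def
  using keys_add by (fastforce simp: in_keys_iff)

lemma multi_degree_add: "multi_degree (\<alpha> + \<beta>) = multi_degree \<alpha> + multi_degree \<beta>"
  by (simp add: multi_degree_def lookup_add sum.distrib)

lemma multi_degree_eq_0_iff: "multi_degree \<alpha> = 0 \<longleftrightarrow> \<alpha> = 0"
  by (auto simp: multi_degree_def poly_mapping_eq_iff fun_eq_iff)

lemma homogeneous_of_degree_pmonom_mult:
  assumes "homogeneous_of_degree d p"
  shows "homogeneous_of_degree (multi_degree \<alpha> + d) (pmonom \<alpha> * p)"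
  using assms keys_mult[of "pmonom \<alpha>" p] unfolding homogeneous_of_degree_def
  by (auto simp: multi_degree_add)

lemma finite_multi_degree_le: "finite {\<alpha> :: 'n::finite \<Rightarrow>\<^sub>0 nat. multi_degree \<alpha> \<le> d}"
proof -
  have "Poly_Mapping.lookup \<alpha> i \<le> multi_degree \<alpha>" for \<alpha> :: "'n \<Rightarrow>\<^sub>0 nat" and i
    unfolding multi_degree_def by (rule member_le_sum) auto
  then have "Poly_Mapping.lookup ` {\<alpha> :: 'n \<Rightarrow>\<^sub>0 nat. multi_degree \<alpha> \<le> d} \<subseteq> (\<Pi>\<^sub>E i\<in>UNIV. {..d})"
    by (auto intro: order_trans)
  moreover have "finite (\<Pi>\<^sub>E i\<in>(UNIV :: 'n set). {..d})" by (intro finite_PiE) auto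
  ultimately have "finite (Poly_Mapping.lookup ` {\<alpha> :: 'n \<Rightarrow>\<^sub>0 nat. multi_degree \<alpha> \<le> d})"
    by (rule finite_subset)
  then show ?thesis by (rule finite_imageD) (intro inj_onI, simp only: poly_mapping_eq_iff)
qed

section \<open>The Fischer inner product\<close>

text \<open>
  This is \<open>(q\<^sup>*(D) p)(0)\<close>, where \<open>q\<^sup>*\<close> has the conjugate coefficients of \<open>q\<close>.
\<close>

definition fischer :: "'n::finite cpoly \<Rightarrow> 'n cpoly \<Rightarrow> complex" where
  "fischer p q = (\<Sum>\<alpha>\<in>Poly_Mapping.keys q.
    cnj (Poly_Mapping.lookup q \<alpha>) * (Poly_Mapping.lookup p \<alpha> * of_real (multi_fact \<alpha>)))"

lemma fischer_superset:
  assumes "finite S" "Poly_Mapping.keys q \<subseteq> S"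
  shows "fischer p q = (\<Sum>\<alpha>\<in>S. cnj (Poly_Mapping.lookup q \<alpha>) * (Poly_Mapping.lookup p \<alpha> * of_real (multi_fact \<alpha>)))"
  unfolding fischer_def by (rule sum.mono_neutral_left) (use assms in \<open>auto simp: in_keys_iff\<close>)

lemma fischer_cnj: "fischer q p = cnj (fischer p q)"
  using fischer_superset[of "Poly_Mapping.keys p \<union> Poly_Mapping.keys q" p q]
    fischer_superset[of "Poly_Mapping.keys p \<union> Poly_Mapping.keys q" q p]
  by (simp add: mult_ac)

lemma fischer_add_left: "fischer (p + p') q = fischer p q + fischer p' q"
  by (simp add: fischer_def lookup_add algebra_simps sum.distrib)

lemma fischer_scale_left: "fischer (poly_scale c p) q = c * fischer p q"
  by (simp add: fischer_def sum_distrib_left mult_ac)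

lemma fischer_0_left [simp]: "fischer 0 q = 0"
  by (simp add: fischer_def)

lemma fischer_add_right: "fischer q (p + p') = fischer q p + fischer q p'"
  using fischer_add_left[of p p' q] by (metis complex_cnj_add fischer_cnj)

lemma fischer_scale_right: "fischer q (poly_scale c p) = cnj c * fischer q p"
  using fischer_scale_left[of c p q] by (metis complex_cnj_mult fischer_cnj)

lemma fischer_0_right [simp]: "fischer q 0 = 0"
  by (simp add: fischer_def)

lemma fischer_diff_right: "fischer q (p - p') = fischer q p - fischer q p'"
  using fischer_add_right[of q "p - p'" p'] by simp

lemma fischer_sum_right: "fischer q (sum f A) = (\<Sum>x\<in>A. fischer q (f x))"
  by (induction A rule: infinite_finite_induct) (simp_all add: fischer_add_right)

lemma fischer_definite: "fischer p p = 0 \<longleftrightarrow> p = 0"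
proof
  assume "fischer p p = 0"
  moreover have "fischer p p = of_real (\<Sum>\<alpha>\<in>Poly_Mapping.keys p. (cmod (Poly_Mapping.lookup p \<alpha>))\<^sup>2 * multi_fact \<alpha>)"
    unfolding fischer_def of_real_sum
    using complex_norm_square by (intro sum.cong) (simp_all add: mult_ac)
  ultimately have sum0: "(\<Sum>\<alpha>\<in>Poly_Mapping.keys p. (cmod (Poly_Mapping.lookup p \<alpha>))\<^sup>2 * multi_fact \<alpha>) = 0" by (metis of_real_eq_0_iff)
  have pos: "multi_fact \<alpha> > 0" for \<alpha> :: "'a \<Rightarrow>\<^sub>0 nat" unfolding multi_fact_def by (intro prod_pos) auto
  have "(cmod (Poly_Mapping.lookup p \<alpha>))\<^sup>2 * multi_fact \<alpha> = 0" if "\<alpha> \<in> Poly_Mapping.keys p" for \<alpha>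
    using sum_nonneg_0[OF finite_keys _ sum0 that] pos[THEN less_imp_le] by simp
  then have "\<alpha> \<notin> Poly_Mapping.keys p" for \<alpha> using pos[of \<alpha>] by (fastforce simp: in_keys_iff)
  then have "Poly_Mapping.keys p = {}" by blast
  then show "p = 0" by simp
qed simp

lemma fischer_orthogonal_degrees:
  assumes "homogeneous_of_degree d p" "homogeneous_of_degree e q" "d \<noteq> e"
  shows "fischer p q = 0"
  unfolding fischer_def
  by (rule sum.neutral) (use assms in \<open>fastforce simp: homogeneous_of_degree_def in_keys_iff\<close>)

text \<open>
  Finite-dimensional Riesz representation, by a Gram-Schmidt induction on the spanning set.  With
  \<open>\<phi> = fischer \<cdot> g\<close> it yields the orthogonal projection of \<open>g\<close>; the induction step uses this instance for the
  new vector.  The functional is linear on a subspace only, because the functionals that arise from the module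
  are meaningful on the ideal only.
\<close>

lemma fischer_representation:
  assumes V: "cpoly.subspace V" and B: "finite B" "B \<subseteq> V"
    and add: "\<And>p q. p \<in> V \<Longrightarrow> q \<in> V \<Longrightarrow> \<phi> (p + q) = \<phi> p + \<phi> q"
    and scale: "\<And>c p. p \<in> V \<Longrightarrow> \<phi> (poly_scale c p) = c * \<phi> p"
  shows "\<exists>u\<in>cpoly.span B. \<forall>b\<in>B. \<phi> b = fischer b u"
  using B add scale
proof (induction B arbitrary: \<phi> rule: finite_induct)
  case empty
  then show ?case by auto
next
  case (insert b B)
  have BV: "B \<subseteq> V" and bV: "b \<in> V" using insert.prems by auto
  obtain u where u: "u \<in> cpoly.span B" "\<And>x. x \<in> B \<Longrightarrow> \<phi> x = fischer x u"
    using insert.IH[OF BV insert.prems(2,3)] by blast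
  obtain w where w: "w \<in> cpoly.span B" "\<And>x. x \<in> B \<Longrightarrow> fischer x b = fischer x w"
    using insert.IH[OF BV, of "\<lambda>x. fischer x b"] by (auto simp: fischer_add_left fischer_scale_left)
  define r where "r = b - w"
  have spV: "cpoly.span B \<subseteq> V" using BV V by (rule cpoly.span_minimal)
  have u': "x \<in> V \<and> \<phi> x = fischer x u" if "x \<in> cpoly.span B" for x
  proof (rule cpoly.span_induct[OF that, of "\<lambda>x. x \<in> V \<and> \<phi> x = fischer x u"])
    have "\<phi> 0 = 0" using insert.prems(3)[of 0 0] cpoly.subspace_0[OF V] by simp
    then show "cpoly.subspace {x. x \<in> V \<and> \<phi> x = fischer x u}"
      using V insert.prems(2,3) unfolding cpoly.subspace_def by (auto simp: fischer_add_left fischer_scale_left)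
  qed (use u BV in auto)
  have r_orth: "fischer x r = 0" if "x \<in> cpoly.span B" for x
  proof (rule cpoly.span_induct[OF that, of "\<lambda>x. fischer x r = 0"])
    show "cpoly.subspace {x. fischer x r = 0}"
      unfolding cpoly.subspace_def by (auto simp: fischer_add_left fischer_scale_left)
  qed (simp add: r_def fischer_diff_right w)
  have sub: "cpoly.span B \<subseteq> cpoly.span (insert b B)" by (rule cpoly.span_mono) auto
  show ?case
  proof (cases "r = 0")
    case True
    then have "b \<in> cpoly.span B" using w by (simp add: r_def)
    then show ?thesis using u u' sub by auto
  next
    case False
    have rV: "r \<in> V" using w bV spV V by (auto simp: r_def cpoly.subspace_diff)
    \<comment> \<open>Adding a multiple of \<open>r\<close> does not change the pairings with \<open>B\<close>; \<open>c\<close> adjusts the one with \<open>r\<close>.\<close>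
    define c where "c = cnj ((\<phi> r - fischer r u) / fischer r r)"
    have nz: "fischer r r \<noteq> 0" using False by (simp add: fischer_definite)
    define u2 where "u2 = u + poly_scale c r"
    have u2: "fischer x u2 = \<phi> x" if "x \<in> cpoly.span B" for x
      using u'[OF that] r_orth[OF that] by (simp add: u2_def fischer_add_right fischer_scale_right)
    have "fischer r u2 = \<phi> r" using nz by (simp add: u2_def fischer_add_right fischer_scale_right c_def)
    moreover have "b = w + r" by (simp add: r_def)
    ultimately have "\<phi> b = fischer b u2"
      using u2[OF w(1)] insert.prems(2)[of w r] rV w(1) spV by (auto simp: fischer_add_left)
    moreover have "u2 \<in> cpoly.span (insert b B)"
      unfolding u2_def r_def using u(1) w(1) sub
      by (intro cpoly.span_add cpoly.span_scale cpoly.span_diff) (auto intro: cpoly.span_base)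
    ultimately show ?thesis using u2 cpoly.span_base[of _ B] by (intro bexI[of _ u2]) auto
  qed
qed

section \<open>Generators orthogonal to the multiples of the ideal by the variables\<close>

text \<open>
  The set \<open>B e\<close> in the proof spans the component of degree \<open>e\<close> of \<open>\<mm>\<^sub>0 I\<close>, where \<open>\<mm>\<^sub>0\<close>
  is the maximal ideal at the origin, and \<open>\<mm>\<^sub>0 I\<close> is spanned by the multiples \<open>pmonom \<alpha> * f\<close>
  with \<open>\<alpha> \<noteq> 0\<close> and \<open>f \<in> I\<close>.  Projecting within a single degree keeps everything finite-dimensional.
\<close>

theorem orthogonal_generators:
  fixes p :: "'i \<Rightarrow> 'n::finite cpoly"
  assumes A: "finite A" and hom: "\<And>i. i \<in> A \<Longrightarrow> homogeneous_of_degree (d i) (p i)"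
    and minimal: "\<And>i. i \<in> A \<Longrightarrow> p i \<notin> ideal.span (p ` (A - {i}))"
  shows "\<exists>q :: 'i \<Rightarrow> 'n cpoly. ideal.span (q ` A) = ideal.span (p ` A) \<and>
    (\<forall>c. (\<Sum>i\<in>A. poly_scale (c i) (q i)) = 0 \<longrightarrow> (\<forall>i\<in>A. c i = 0)) \<and>
    (\<forall>i\<in>A. \<forall>\<alpha> f. \<alpha> \<noteq> 0 \<longrightarrow> f \<in> ideal.span (p ` A) \<longrightarrow> fischer (pmonom \<alpha> * f) (q i) = 0) \<and>
    ideal.span (p ` A) \<subseteq>
      cpoly.span (q ` A \<union> {pmonom \<alpha> * f |\<alpha> f. \<alpha> \<noteq> 0 \<and> f \<in> ideal.span (p ` A)})"
proof -
  define I where "I = ideal.span (p ` A)"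
  have I: "ideal.subspace I" unfolding I_def by (rule ideal.subspace_span)
  have pI: "p i \<in> I" if "i \<in> A" for i unfolding I_def using that by (auto intro: ideal.span_base)
  define B where "B e = {pmonom \<alpha> * p k |\<alpha> k. k \<in> A \<and> \<alpha> \<noteq> 0 \<and> multi_degree \<alpha> + d k = e}" for e
  have "B e \<subseteq> (\<lambda>(\<alpha>, k). pmonom \<alpha> * p k) ` ({\<alpha>. multi_degree \<alpha> \<le> e} \<times> A)" for e
    unfolding B_def by auto
  then have finB: "finite (B e)" for e
    by (rule finite_subset) (intro finite_imageI finite_cartesian_product finite_multi_degree_le A)
  have "\<exists>w\<in>cpoly.span (B e). \<forall>b\<in>B e. fischer b g = fischer b w" for e g
    using fischer_representation[OF cpoly.subspace_UNIV finB, of e "\<lambda>x. fischer x g"]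
    by (simp add: fischer_add_left fischer_scale_left)
  then have "\<forall>i. \<exists>w. w \<in> cpoly.span (B (d i)) \<and> (\<forall>b\<in>B (d i). fischer b (p i) = fischer b w)" by blast
  then obtain w where w: "\<And>i. w i \<in> cpoly.span (B (d i))"
    and w_proj: "\<And>i b. b \<in> B (d i) \<Longrightarrow> fischer b (p i) = fischer b (w i)" by metis
  define q where "q i = p i - w i" for i
  have homB: "homogeneous_of_degree e b" if "b \<in> B e" for b e
    using that hom homogeneous_of_degree_pmonom_mult unfolding B_def by blast
  have hom_w: "homogeneous_of_degree (d i) (w i)" for i
    using cpoly.span_minimal[OF _ subspace_homogeneous_of_degree, of "B (d i)" "d i"] homB w[of i] by blast
  have hom_q: "homogeneous_of_degree (d i) (q i)" if "i \<in> A" for i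
    using cpoly.subspace_diff[OF subspace_homogeneous_of_degree, of "p i" "d i" "w i"] hom[OF that] hom_w
    by (simp add: q_def)
  \<comment> \<open>Nontrivial monomials have positive degree, so \<open>B (d i)\<close> involves only generators of degree less than \<open>d i\<close>.\<close>
  have w_lower: "w i \<in> ideal.span (p ` {k \<in> A. d k < d i})" for i
  proof -
    have "B (d i) \<subseteq> ideal.span (p ` {k \<in> A. d k < d i})"
      unfolding B_def using multi_degree_eq_0_iff
      by (fastforce intro!: ideal.span_scale intro: ideal.span_base)
    then have "cpoly.span (B (d i)) \<subseteq> ideal.span (p ` {k \<in> A. d k < d i})"
      by (rule cpoly.span_minimal) (intro ideal_imp_cpoly_subspace ideal.subspace_span)
    then show ?thesis using w by blast
  qed
  have wI: "w i \<in> I" for i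
    using w_lower[of i] ideal.span_mono[of "p ` {k \<in> A. d k < d i}" "p ` A"] unfolding I_def by blast
  have qI: "q i \<in> I" if "i \<in> A" for i
    unfolding q_def using I pI[OF that] wI by (rule ideal.subspace_diff)
  have orth_gen: "fischer (pmonom \<alpha> * p k) (q i) = 0" if "i \<in> A" "k \<in> A" "\<alpha> \<noteq> 0" for i k \<alpha>
  proof (cases "multi_degree \<alpha> + d k = d i")
    case True
    then have "pmonom \<alpha> * p k \<in> B (d i)" using that unfolding B_def by blast
    then show ?thesis using w_proj by (simp add: q_def fischer_diff_right)
  next
    case False
    then show ?thesis
      using fischer_orthogonal_degrees[OF homogeneous_of_degree_pmonom_mult[OF hom[OF that(2)]] hom_q[OF that(1)]] by blast
  qed
  have orth: "fischer (pmonom \<alpha> * f) (q i) = 0" if i: "i \<in> A" and "\<alpha> \<noteq> 0" and f: "f \<in> I" for i \<alpha> f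
  proof -
    define S where "S = {f. \<forall>\<alpha>. \<alpha> \<noteq> 0 \<longrightarrow> fischer (pmonom \<alpha> * f) (q i) = 0}"
    have "ideal.subspace S"
    proof (rule cpoly_subspace_imp_ideal)
      show "cpoly.subspace S"
        unfolding cpoly.subspace_def S_def
        by (auto simp: distrib_left fischer_add_left poly_scale_mult_right fischer_scale_left)
      fix \<beta> f assume f: "f \<in> S"
      show "pmonom \<beta> * f \<in> S"
        unfolding S_def
      proof (intro CollectI allI impI)
        fix \<alpha> :: "'n \<Rightarrow>\<^sub>0 nat" assume "\<alpha> \<noteq> 0"
        then have "\<alpha> + \<beta> \<noteq> 0" by (metis add_is_0 multi_degree_add multi_degree_eq_0_iff)
        then show "fischer (pmonom \<alpha> * (pmonom \<beta> * f)) (q i) = 0"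
          using f unfolding S_def pmonom_mult_pmonom by blast
      qed
    qed
    moreover have "p ` A \<subseteq> S" using orth_gen[OF i] unfolding S_def by blast
    ultimately have "I \<subseteq> S" unfolding I_def by (intro ideal.span_minimal)
    then show ?thesis using that unfolding S_def by blast
  qed
  have gen: "ideal.span (q ` A) = I"
  proof
    show "ideal.span (q ` A) \<subseteq> I" using qI I by (intro ideal.span_minimal) auto
    have "\<forall>i\<in>A. d i = e \<longrightarrow> p i \<in> ideal.span (q ` A)" for e
    proof (induction e rule: less_induct)
      case (less e)
      show ?case
      proof (intro ballI impI)
        fix i assume i: "i \<in> A" and e: "d i = e"
        have "p ` {k \<in> A. d k < d i} \<subseteq> ideal.span (q ` A)" using less e by blast
        then have "w i \<in> ideal.span (q ` A)"
          using w_lower[of i] ideal.span_minimal[OF _ ideal.subspace_span] by blast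
        then have "q i + w i \<in> ideal.span (q ` A)" using i by (intro ideal.span_add) (auto intro: ideal.span_base)
        then show "p i \<in> ideal.span (q ` A)" by (simp add: q_def)
      qed
    qed
    then show "I \<subseteq> ideal.span (q ` A)"
      unfolding I_def by (intro ideal.span_minimal ideal.subspace_span) blast
  qed
  have indep: "c i0 = 0" if sum0: "(\<Sum>i\<in>A. poly_scale (c i) (q i)) = 0" and i0: "i0 \<in> A" for c i0
  proof (rule ccontr)
    assume c: "c i0 \<noteq> 0"
    define S where "S = {i \<in> A. d i = d i0}"
    \<comment> \<open>The part \<open>r\<close> of degree \<open>d i0\<close> of the relation is orthogonal to the other parts, hence zero by itself.\<close>
    define r where "r = (\<Sum>i\<in>S. poly_scale (c i) (q i))"
    have "homogeneous_of_degree (d i0) (q i)" if "i \<in> S" for i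
      using hom_q[of i] that by (simp add: S_def)
    then have "r \<in> {p. homogeneous_of_degree (d i0) p}"
      unfolding r_def
      by (intro cpoly.subspace_sum cpoly.subspace_scale subspace_homogeneous_of_degree) simp
    then have "fischer r (q i) = 0" if "i \<in> A - S" for i
      using fischer_orthogonal_degrees[of "d i0" r "d i" "q i"] hom_q[of i] that by (auto simp: S_def)
    then have "fischer r (\<Sum>i\<in>A - S. poly_scale (c i) (q i)) = 0"
      unfolding fischer_sum_right by (intro sum.neutral ballI) (simp add: fischer_scale_right)
    moreover have "r + (\<Sum>i\<in>A - S. poly_scale (c i) (q i)) = 0"
      using sum0 sum.subset_diff[of S A "\<lambda>i. poly_scale (c i) (q i)"] A
      unfolding r_def S_def by (simp add: add.commute)
    then have "fischer r (r + (\<Sum>i\<in>A - S. poly_scale (c i) (q i))) = 0" by simp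
    ultimately have "fischer r r = 0" by (simp add: fischer_add_right)
    then have r0: "r = 0" by (simp add: fischer_definite)
    define J where "J = ideal.span (p ` (A - {i0}))"
    have J: "cpoly.subspace J" unfolding J_def by (intro ideal_imp_cpoly_subspace ideal.subspace_span)
    have wJ: "w i \<in> J" if "i \<in> S" for i
      using w_lower[of i] that ideal.span_mono[of "p ` {k \<in> A. d k < d i}" "p ` (A - {i0})"] unfolding J_def S_def by auto
    have qJ: "q i \<in> J" if "i \<in> S - {i0}" for i
      unfolding q_def using wJ[of i] that
      by (intro cpoly.subspace_diff[OF J]) (auto simp: J_def S_def intro: ideal.span_base)
    have "i0 \<in> S" using i0 by (simp add: S_def)
    then have "r = poly_scale (c i0) (q i0) + (\<Sum>i\<in>S - {i0}. poly_scale (c i) (q i))"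
      unfolding r_def using A by (intro sum.remove) (auto simp: S_def)
    then have "poly_scale (c i0) (q i0) = - (\<Sum>i\<in>S - {i0}. poly_scale (c i) (q i))"
      using r0 by (simp add: eq_neg_iff_add_eq_0)
    also have "\<dots> \<in> J"
      using qJ by (intro cpoly.subspace_neg[OF J] cpoly.subspace_sum[OF J] cpoly.subspace_scale[OF J]) auto
    finally have "poly_scale (1 / c i0) (poly_scale (c i0) (q i0)) \<in> J" by (rule cpoly.subspace_scale[OF J])
    then have "q i0 \<in> J" using c by simp
    then have "q i0 + w i0 \<in> J" using wJ[OF \<open>i0 \<in> S\<close>] by (rule cpoly.subspace_add[OF J])
    then show False using minimal[OF i0] by (simp add: q_def J_def)
  qed
  define N where "N = {pmonom \<alpha> * f |\<alpha> f. \<alpha> \<noteq> 0 \<and> f \<in> I}"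
  have NI: "N \<subseteq> I" unfolding N_def using ideal.subspace_scale[OF I] by blast
  have "I \<subseteq> cpoly.span (q ` A \<union> N) \<inter> I"
  proof -
    have "ideal.subspace (cpoly.span (q ` A \<union> N) \<inter> I)"
    proof (rule cpoly_subspace_imp_ideal)
      show "cpoly.subspace (cpoly.span (q ` A \<union> N) \<inter> I)"
        by (intro cpoly.subspace_inter cpoly.subspace_span ideal_imp_cpoly_subspace I)
      fix \<alpha> f assume f: "f \<in> cpoly.span (q ` A \<union> N) \<inter> I"
      show "pmonom \<alpha> * f \<in> cpoly.span (q ` A \<union> N) \<inter> I"
      proof (cases "\<alpha> = 0")
        case False
        then have "pmonom \<alpha> * f \<in> N" using f unfolding N_def by blast
        then show ?thesis using NI by (auto intro: cpoly.span_base)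
      qed (use f in simp)
    qed
    moreover have "p i \<in> cpoly.span (q ` A \<union> N)" if "i \<in> A" for i
    proof -
      have "B (d i) \<subseteq> N" unfolding B_def N_def using pI by blast
      then have "w i \<in> cpoly.span (q ` A \<union> N)" using w[of i] cpoly.span_mono[of "B (d i)" "q ` A \<union> N"] by blast
      then have "q i + w i \<in> cpoly.span (q ` A \<union> N)" using that by (intro cpoly.span_add) (auto intro: cpoly.span_base)
      then show ?thesis by (simp add: q_def)
    qed
    ultimately show ?thesis unfolding I_def[symmetric] 
      using ideal.span_minimal[of "p ` A" "cpoly.span (q ` A \<union> N) \<inter> I"] pI I_def by blast
  qed
  then have "I \<subseteq> cpoly.span (q ` A \<union> N)" by blast
  then show ?thesis
    unfolding I_def[symmetric] N_def[symmetric]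
    by (intro exI[of _ q] conjI allI impI ballI gen indep orth)
qed

section \<open>Pairing polynomials with derivatives of the kernel\<close>

lemma poly_eval_superset:
  assumes "finite S" "Poly_Mapping.keys p \<subseteq> S"
  shows "poly_eval p z = (\<Sum>\<alpha>\<in>S. Poly_Mapping.lookup p \<alpha> * (\<Prod>i\<in>UNIV. z $ i ^ Poly_Mapping.lookup \<alpha> i))"
  unfolding poly_eval_def by (rule sum.mono_neutral_left) (use assms in \<open>auto simp: in_keys_iff\<close>)

lemma poly_eval_add: "poly_eval (p + q) z = poly_eval p z + poly_eval q z"
proof -
  let ?S = "Poly_Mapping.keys p \<union> Poly_Mapping.keys q"
  have "Poly_Mapping.keys (p + q) \<subseteq> ?S" by (rule keys_add)
  then show ?thesis
    by (simp add: poly_eval_superset[of ?S] lookup_add distrib_right sum.distrib)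
qed

lemma poly_eval_scale: "poly_eval (poly_scale c p) z = c * poly_eval p z"
proof -
  have "Poly_Mapping.keys (poly_scale c p) \<subseteq> Poly_Mapping.keys p" by (auto simp: in_keys_iff)
  then show ?thesis
    by (simp add: poly_eval_superset[of "Poly_Mapping.keys p"] sum_distrib_left mult.assoc)
qed

lemma poly_eval_sum: "poly_eval (sum f A) z = (\<Sum>x\<in>A. poly_eval (f x) z)"
  by (induction A rule: infinite_finite_induct) (simp_all add: poly_eval_add, simp_all add: poly_eval_def)

lemma poly_eval_pmonom: "poly_eval (pmonom \<alpha>) z = (\<Prod>i\<in>UNIV. z $ i ^ Poly_Mapping.lookup \<alpha> i)"
  by (simp add: poly_eval_def)

lemma poly_eval_pmonom_mult: "poly_eval (pmonom \<alpha> * p) z = poly_eval (pmonom \<alpha>) z * poly_eval p z"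
proof -
  have "pmonom \<alpha> * p = (\<Sum>\<beta>\<in>Poly_Mapping.keys p. poly_scale (Poly_Mapping.lookup p \<beta>) (pmonom (\<alpha> + \<beta>)))"
    by (subst poly_expansion[of p]) (simp add: sum_distrib_left poly_scale_mult_right mult_single)
  then have "poly_eval (pmonom \<alpha> * p) z = (\<Sum>\<beta>\<in>Poly_Mapping.keys p. Poly_Mapping.lookup p \<beta> * poly_eval (pmonom (\<alpha> + \<beta>)) z)"
    by (simp add: poly_eval_sum poly_eval_scale)
  also have "\<dots> = poly_eval (pmonom \<alpha>) z * poly_eval p z"
    unfolding poly_eval_pmonom
    by (simp add: poly_eval_def sum_distrib_left lookup_add power_add prod.distrib mult_ac)
  finally show ?thesis .
qed

lemma poly_on_add: "poly_on \<Omega> (p + q) = poly_on \<Omega> p + poly_on \<Omega> q"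
  by (auto simp: poly_on_def poly_eval_add fun_eq_iff)

lemma poly_on_scale: "poly_on \<Omega> (poly_scale c p) = fun_scale c (poly_on \<Omega> p)"
  by (auto simp: poly_on_def poly_eval_scale fun_scale_def fun_eq_iff)

definition pvar :: "'n::finite \<Rightarrow> 'n cpoly" where
  "pvar j = pmonom (Poly_Mapping.single j 1)"

lemma poly_on_pvar_mult: "poly_on \<Omega> (pvar j * p) = coord_mult j (poly_on \<Omega> p)"
proof -
  have "(\<Prod>i\<in>UNIV. z $ i ^ Poly_Mapping.lookup (Poly_Mapping.single j 1) i) = (\<Prod>i\<in>UNIV. if i = j then z $ j else 1)"
    for z :: "complex ^ 'a"
    by (rule prod.cong) (auto simp: lookup_single when_def)
  then have "poly_eval (pvar j) z = z $ j" for z by (simp add: pvar_def poly_eval_pmonom)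
  then show ?thesis
    by (simp add: poly_on_def coord_mult_def pvar_def poly_eval_pmonom_mult fun_eq_iff)
qed

lemma pmonom_factor_variable:
  assumes "\<alpha> \<noteq> 0" obtains j \<beta> where "pmonom \<alpha> = pvar j * pmonom \<beta>"
proof -
  obtain j where j: "Poly_Mapping.lookup \<alpha> j \<noteq> 0" using assms poly_mapping_eqI[of \<alpha> 0] by auto
  have "\<alpha> = Poly_Mapping.single j 1 + (\<alpha> - Poly_Mapping.single j 1)"
    by (rule poly_mapping_eqI) (use j in \<open>auto simp: lookup_add lookup_minus lookup_single when_def\<close>)
  then show thesis using that[of j "\<alpha> - Poly_Mapping.single j 1"] by (simp add: pvar_def mult_single)
qed

lemma sum_fun_scale_apply: "(\<Sum>x\<in>A. fun_scale (c x) (f x)) z = (\<Sum>x\<in>A. c x * f x z)"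
  by (induction A rule: infinite_finite_induct) (simp_all add: fun_scale_def)

lemma poly_dbar_kernel_superset:
  assumes "finite S" "Poly_Mapping.keys q \<subseteq> S"
  shows "poly_dbar_kernel q K w =
    (\<Sum>\<alpha>\<in>S. fun_scale (Poly_Mapping.lookup q \<alpha>) (\<lambda>z. dbar_multi \<alpha> (\<lambda>u. K z u) w))"
proof
  fix z
  show "poly_dbar_kernel q K w z =
      (\<Sum>\<alpha>\<in>S. fun_scale (Poly_Mapping.lookup q \<alpha>) (\<lambda>z. dbar_multi \<alpha> (\<lambda>u. K z u) w)) z"
    unfolding sum_fun_scale_apply poly_dbar_kernel_def
    by (rule sum.mono_neutral_left) (use assms in \<open>auto simp: in_keys_iff\<close>)
qed

lemma poly_dbar_kernel_add: "poly_dbar_kernel (p + q) K w = poly_dbar_kernel p K w + poly_dbar_kernel q K w"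
proof -
  let ?S = "Poly_Mapping.keys p \<union> Poly_Mapping.keys q"
  have "Poly_Mapping.keys (p + q) \<subseteq> ?S" by (rule keys_add)
  then show ?thesis
    by (simp add: poly_dbar_kernel_superset[of ?S] lookup_add cfun.scale_left_distrib sum.distrib)
qed

lemma poly_dbar_kernel_scale: "poly_dbar_kernel (poly_scale c q) K w = fun_scale c (poly_dbar_kernel q K w)"
proof -
  have "Poly_Mapping.keys (poly_scale c q) \<subseteq> Poly_Mapping.keys q" by (auto simp: in_keys_iff)
  then show ?thesis
    by (simp add: poly_dbar_kernel_superset[of "Poly_Mapping.keys q"] cfun.scale_sum_right)
qed

lemma poly_dbar_kernel_0: "poly_dbar_kernel 0 K w = 0"
  by (simp add: poly_dbar_kernel_def fun_eq_iff)

lemma poly_dbar_kernel_sum: "poly_dbar_kernel (sum f A) K w = (\<Sum>x\<in>A. poly_dbar_kernel (f x) K w)"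
  by (induction A rule: infinite_finite_induct) (simp_all add: poly_dbar_kernel_add poly_dbar_kernel_0)

lemma (in hilbert_function_space) poly_dbar_kernel_mem:
  assumes "open \<Omega>" "reproducing_kernel \<Omega> H ip K" "w \<in> \<Omega>"
  shows "poly_dbar_kernel q K w \<in> H"
  unfolding poly_dbar_kernel_superset[OF finite_keys order_refl]
  using dbar_multi_kernel(1)[OF assms] by (intro sum_mem scale_mem)

text \<open>
  The inner product of the space does not enter the right-hand side: the kernel turns it into evaluation of
  derivatives at the origin, that is, into Taylor coefficients.
\<close>

lemma (in hilbert_function_space) ip_poly_dbar_kernel:
  assumes op: "open \<Omega>" and ker: "reproducing_kernel \<Omega> H ip K" and 0: "0 \<in> \<Omega>" and p: "poly_on \<Omega> p \<in> H"
  shows "ip (poly_on \<Omega> p) (poly_dbar_kernel q K 0) = fischer p q"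
proof -
  note mem = dbar_multi_kernel(1)[OF op ker 0]
  have "ip (poly_on \<Omega> p) (\<lambda>z. dbar_multi \<alpha> (\<lambda>u. K z u) 0) = Poly_Mapping.lookup p \<alpha> * of_real (multi_fact \<alpha>)" for \<alpha>
  proof -
    have "cpartial_multi \<alpha> (poly_on \<Omega> p) 0 = cpartial_multi \<alpha> (poly_eval p) 0"
      by (rule cpartial_multi_cong_open[OF op 0]) (simp add: poly_on_def)
    then show ?thesis unfolding dbar_multi_kernel(2)[OF op ker 0 p] cpartial_multi_poly_eval_0 .
  qed
  then show ?thesis
    unfolding poly_dbar_kernel_superset[OF finite_keys order_refl] fischer_def
    by (subst ip_sum_right) (auto simp: mem scale_mem p ip_scale_right)
qed

section \<open>The common kernel of the adjoints\<close>

lemma (in hilbert_function_space) dense_orthogonal_imp_0: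
  assumes dense: "\<And>f e. f \<in> H \<Longrightarrow> 0 < e \<Longrightarrow> \<exists>p\<in>D. ip_norm ip (f - p) < e" and D: "D \<subseteq> H"
    and g: "g \<in> H" and orth: "\<And>p. p \<in> D \<Longrightarrow> ip p g = 0"
  shows "g = 0"
proof (rule ccontr)
  assume "g \<noteq> 0"
  then have pos: "0 < ip_norm ip g" using norm_eq_0_iff[OF g] norm_nonneg[OF g] by linarith
  then obtain p where p: "p \<in> D" "ip_norm ip (g - p) < ip_norm ip g" using dense[OF g] by blast
  have pH: "p \<in> H" using p D by blast
  have "of_real ((ip_norm ip g)\<^sup>2) = ip (g - p) g" using ip_self[OF g] g pH orth[OF p(1)] by (simp add: ip_diff)
  then have "(ip_norm ip g)\<^sup>2 = cmod (ip (g - p) g)" by (metis norm_of_real abs_of_nonneg zero_le_power2)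
  also have "\<dots> \<le> ip_norm ip (g - p) * ip_norm ip g" using g pH by (intro Cauchy_Schwarz diff_mem)
  also have "\<dots> < ip_norm ip g * ip_norm ip g" using p(2) pos by (intro mult_strict_right_mono)
  finally show False by (simp add: power2_eq_square)
qed

lemma (in hilbert_module) coord_mult_adjoint:
  assumes g: "g \<in> H"
  shows "adjoint_on H ip (coord_mult j) g \<in> H"
    and "\<And>f. f \<in> H \<Longrightarrow> ip (coord_mult j f) g = ip f (adjoint_on H ip (coord_mult j) g)"
proof -
  obtain C where C: "\<And>f. f \<in> H \<Longrightarrow> ip_norm ip (coord_mult j f) \<le> C * ip_norm ip f"
    using coord_mult_bounded by blast
  have ex: "\<exists>h\<in>H. \<forall>f\<in>H. ip (coord_mult j f) g = ip f h"
  proof (rule Riesz_representation)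
    show "ip (coord_mult j (e + f)) g = ip (coord_mult j e) g + ip (coord_mult j f) g" if "e \<in> H" "f \<in> H" for e f
    proof -
      have "coord_mult j (e + f) = coord_mult j e + coord_mult j f"
        by (simp add: coord_mult_def fun_eq_iff distrib_left)
      then show ?thesis using that g by (simp add: ip_add coord_mult_closed)
    qed
    show "ip (coord_mult j (fun_scale c f)) g = c * ip (coord_mult j f) g" if "f \<in> H" for c f
    proof -
      have "coord_mult j (fun_scale c f) = fun_scale c (coord_mult j f)"
        by (simp add: coord_mult_def fun_scale_def fun_eq_iff)
      then show ?thesis using that g by (simp add: ip_scale coord_mult_closed)
    qed
    show "cmod (ip (coord_mult j f) g) \<le> (C * ip_norm ip g) * ip_norm ip f" if "f \<in> H" for f
      using Cauchy_Schwarz[OF coord_mult_closed[OF that] g, of j] mult_right_mono[OF C[OF that] norm_nonneg[OF g]]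
      by (simp add: mult_ac)
  qed
  have "\<exists>!h. h \<in> H \<and> (\<forall>f\<in>H. ip (coord_mult j f) g = ip f h)"
  proof (rule ex_ex1I)
    show "\<exists>h. h \<in> H \<and> (\<forall>f\<in>H. ip (coord_mult j f) g = ip f h)" using ex by blast
    fix h k assume "h \<in> H \<and> (\<forall>f\<in>H. ip (coord_mult j f) g = ip f h)" "k \<in> H \<and> (\<forall>f\<in>H. ip (coord_mult j f) g = ip f k)"
    then have hk: "h \<in> H" "k \<in> H" "\<And>f. f \<in> H \<Longrightarrow> ip f h = ip f k" by auto
    have "ip (h - k) (h - k) = 0"
      using hk diff_mem[OF hk(1,2)] by (simp add: ip_diff_right)
    then have "h - k = 0" using ip_pos[OF diff_mem[OF hk(1,2)]] by force
    then show "h = k" by simp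
  qed
  from theI'[OF this] show "adjoint_on H ip (coord_mult j) g \<in> H"
    and "\<And>f. f \<in> H \<Longrightarrow> ip (coord_mult j f) g = ip f (adjoint_on H ip (coord_mult j) g)"
    unfolding adjoint_on_def by blast+
qed

text \<open>
  A vector annihilated by all adjoints is one orthogonal to the ranges of all \<open>M\<^sub>j\<close>, and by density and
  boundedness it is enough to test this on the ideal.
\<close>

lemma completion_module_kernel_adjoints:
  assumes "completion_module \<Omega> I H ip"
  shows "g \<in> (\<Inter>j\<in>UNIV. kernel_on H (adjoint_on H ip (coord_mult j))) \<longleftrightarrow>
    g \<in> H \<and> (\<forall>j. \<forall>p\<in>I. ip (poly_on \<Omega> (pvar j * p)) g = 0)"
proof -
  interpret hilbert_module \<Omega> H ip using assms by (simp add: completion_module_def)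
  have sub: "poly_on \<Omega> ` I \<subseteq> H"
    and dense: "\<And>f e. f \<in> H \<Longrightarrow> 0 < e \<Longrightarrow> \<exists>p\<in>poly_on \<Omega> ` I. ip_norm ip (f - p) < e"
    using assms by (auto simp: completion_module_def)
  have "adjoint_on H ip (coord_mult j) g = 0 \<longleftrightarrow> (\<forall>p\<in>I. ip (poly_on \<Omega> (pvar j * p)) g = 0)" if g: "g \<in> H" for j
  proof
    assume "adjoint_on H ip (coord_mult j) g = 0"
    then have "ip (coord_mult j f) g = 0" if "f \<in> H" for f
      using coord_mult_adjoint(2)[OF g that, of j] ip_zero_right[OF that] by simp
    then show "\<forall>p\<in>I. ip (poly_on \<Omega> (pvar j * p)) g = 0" using sub by (auto simp: poly_on_pvar_mult)
  next
    assume "\<forall>p\<in>I. ip (poly_on \<Omega> (pvar j * p)) g = 0"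
    then have "ip (poly_on \<Omega> p) (adjoint_on H ip (coord_mult j) g) = 0" if "p \<in> I" for p
      using that sub coord_mult_adjoint(2)[OF g, of "poly_on \<Omega> p" j] by (auto simp: poly_on_pvar_mult)
    then show "adjoint_on H ip (coord_mult j) g = 0"
      by (intro dense_orthogonal_imp_0[OF dense sub coord_mult_adjoint(1)[OF g]]) auto
  qed
  then show ?thesis unfolding kernel_on_def by blast
qed

section \<open>A basis of the common kernel\<close>

lemma (in vector_space) independent_family_image:
  assumes "finite A" and indep: "\<forall>c. (\<Sum>i\<in>A. scale (c i) (x i)) = 0 \<longrightarrow> (\<forall>i\<in>A. c i = 0)"
  shows "inj_on x A" "independent (x ` A)"
proof -
  show inj: "inj_on x A"
  proof (rule inj_onI, rule ccontr)
    fix i j assume ij: "i \<in> A" "j \<in> A" "x i = x j" "i \<noteq> j"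
    have "(\<Sum>k\<in>A. scale (if k = i then 1 else if k = j then - 1 else 0) (x k)) =
        (\<Sum>k\<in>A. (if k = i then x i else 0) - (if k = j then x i else 0))"
      by (rule sum.cong) (use ij in auto)
    also have "\<dots> = 0" using ij assms(1) by (simp add: sum_subtractf)
    finally show False using indep[rule_format, of "\<lambda>k. if k = i then 1 else if k = j then - 1 else 0" i] ij(1) by simp
  qed
  show "independent (x ` A)"
  proof (rule independent_if_scalars_zero)
    fix c v assume "(\<Sum>v\<in>x ` A. scale (c v) v) = 0" "v \<in> x ` A"
    then show "c v = 0" using indep[rule_format, of "\<lambda>i. c (x i)"] by (auto simp: sum.reindex[OF inj])
  qed (use assms(1) in simp)
qed

theorem theorem2p9:
  fixes \<Omega> :: "(complex ^ 'n::finite) set"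
    and I :: "'n cpoly set"
    and p :: "nat \<Rightarrow> 'n cpoly"
    and v :: nat
    and H :: "(complex ^ 'n \<Rightarrow> complex) set"
    and ip :: "'n cfun_inner"
    and K :: "complex ^ 'n \<Rightarrow> complex ^ 'n \<Rightarrow> complex"
  assumes "open \<Omega>" and "connected \<Omega>" and "bounded \<Omega>" and "0 \<in> \<Omega>"
    and "homogeneous_ideal I"
    and "inj_on p {1..v}"
    and "\<forall>i\<in>{1..v}. homogeneous_poly (p i)"
    and "minimal_generators I (p ` {1..v})"
    and "completion_module \<Omega> I H ip"
    and "class_B1 \<Omega> H ip"
    and "reproducing_kernel \<Omega> H ip K"
  shows "\<exists>q :: nat \<Rightarrow> 'n cpoly.
    ideal.span (q ` {1..v}) = I \<and>
    inj_on (\<lambda>i. poly_dbar_kernel (q i) K 0) {1..v} \<and>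
    cfun.independent ((\<lambda>i. poly_dbar_kernel (q i) K 0) ` {1..v}) \<and>
    cfun.span ((\<lambda>i. poly_dbar_kernel (q i) K 0) ` {1..v}) =
      (\<Inter>j\<in>UNIV. kernel_on H (adjoint_on H ip (coord_mult j)))"
proof -
  let ?A = "{1..v}"
  interpret hilbert_module \<Omega> H ip using assms(9) by (simp add: completion_module_def)
  have sub: "poly_on \<Omega> f \<in> H" if "f \<in> I" for f
    using assms(9) that by (auto simp: completion_module_def)
  have dense: "\<exists>p\<in>poly_on \<Omega> ` I. ip_norm ip (f - p) < e" if "f \<in> H" "0 < e" for f e
    using assms(9) that by (auto simp: completion_module_def)
  have spanI: "ideal.span (p ` ?A) = I" using assms(8) by (simp add: minimal_generators_def)
  then have I: "ideal.subspace I" using ideal.subspace_span by blast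
  have "\<forall>i\<in>?A. \<exists>d. homogeneous_of_degree d (p i)"
    using assms(7) by (simp add: homogeneous_poly_def homogeneous_of_degree_def)
  then obtain d where d: "\<And>i. i \<in> ?A \<Longrightarrow> homogeneous_of_degree (d i) (p i)" by metis
  have minimal: "p i \<notin> ideal.span (p ` (?A - {i}))" if i: "i \<in> ?A" for i
  proof
    assume "p i \<in> ideal.span (p ` (?A - {i}))"
    then have "p ` ?A \<subseteq> ideal.span (p ` (?A - {i}))"
      using ideal.span_base[of _ "p ` (?A - {i})"] by blast
    then have "ideal.span (p ` ?A) \<subseteq> ideal.span (p ` (?A - {i}))"
      by (rule ideal.span_minimal[OF _ ideal.subspace_span])
    moreover have "ideal.span (p ` (?A - {i})) \<subseteq> ideal.span (p ` ?A)" by (rule ideal.span_mono) auto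
    ultimately have "ideal.span (p ` (?A - {i})) = I" using spanI by blast
    moreover have "p ` (?A - {i}) \<subset> p ` ?A"
      using i assms(6) inj_on_image_set_diff[OF assms(6), of ?A "{i}"] by auto
    moreover have "\<forall>G'. G' \<subset> p ` ?A \<longrightarrow> ideal.span G' \<noteq> I"
      using assms(8) unfolding minimal_generators_def by (rule conjunct2)
    ultimately show False by metis
  qed
  obtain q where q: "ideal.span (q ` ?A) = I \<and>
      (\<forall>c. (\<Sum>i\<in>?A. poly_scale (c i) (q i)) = 0 \<longrightarrow> (\<forall>i\<in>?A. c i = 0)) \<and>
      (\<forall>i\<in>?A. \<forall>\<alpha> f. \<alpha> \<noteq> 0 \<longrightarrow> f \<in> I \<longrightarrow> fischer (pmonom \<alpha> * f) (q i) = 0) \<and>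
      I \<subseteq> cpoly.span (q ` ?A \<union> {pmonom \<alpha> * f |\<alpha> f. \<alpha> \<noteq> 0 \<and> f \<in> I})"
    by (rule exE[OF orthogonal_generators[of ?A d p, OF finite_atLeastAtMost d minimal, unfolded spanI]])
  then have q_gen: "ideal.span (q ` ?A) = I"
    and q_indep: "\<And>c i. (\<Sum>i\<in>?A. poly_scale (c i) (q i)) = 0 \<Longrightarrow> i \<in> ?A \<Longrightarrow> c i = 0"
    and q_orth: "\<And>i \<alpha> f. i \<in> ?A \<Longrightarrow> \<alpha> \<noteq> 0 \<Longrightarrow> f \<in> I \<Longrightarrow> fischer (pmonom \<alpha> * f) (q i) = 0"
    and q_span: "I \<subseteq> cpoly.span (q ` ?A \<union> {pmonom \<alpha> * f |\<alpha> f. \<alpha> \<noteq> 0 \<and> f \<in> I})"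
    by (elim conjE, simp)+
  have qI: "q i \<in> I" if "i \<in> ?A" for i
    unfolding q_gen[symmetric] using that by (intro ideal.span_base imageI)
  define \<Gamma> where "\<Gamma> u = poly_dbar_kernel u K 0" for u
  note \<Gamma>_mem = poly_dbar_kernel_mem[OF assms(1) assms(11) assms(4), folded \<Gamma>_def]
  have ip_\<Gamma>: "ip (poly_on \<Omega> f) (\<Gamma> u) = fischer f u" if "f \<in> I" for f u
    unfolding \<Gamma>_def by (rule ip_poly_dbar_kernel[OF assms(1) assms(11) assms(4) sub[OF that]])
  have \<Gamma>_sum: "\<Gamma> (\<Sum>i\<in>?A. poly_scale (c i) (q i)) = (\<Sum>i\<in>?A. fun_scale (c i) (\<Gamma> (q i)))" for c
    by (simp add: \<Gamma>_def poly_dbar_kernel_sum poly_dbar_kernel_scale)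
  have \<Gamma>_indep: "\<forall>c. (\<Sum>i\<in>?A. fun_scale (c i) (\<Gamma> (q i))) = 0 \<longrightarrow> (\<forall>i\<in>?A. c i = 0)"
  proof (intro allI impI ballI)
    fix c i assume sum0: "(\<Sum>i\<in>?A. fun_scale (c i) (\<Gamma> (q i))) = 0" and i: "i \<in> ?A"
    define u where "u = (\<Sum>i\<in>?A. poly_scale (c i) (q i))"
    have "u \<in> I" unfolding u_def
      using qI by (intro cpoly.subspace_sum cpoly.subspace_scale ideal_imp_cpoly_subspace I)
    then have "fischer u u = ip (poly_on \<Omega> u) (\<Gamma> u)" by (simp add: ip_\<Gamma>)
    also have "\<Gamma> u = 0" unfolding u_def \<Gamma>_sum by (rule sum0)
    also have "ip (poly_on \<Omega> u) 0 = 0" using \<open>u \<in> I\<close> by (intro ip_zero_right sub)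
    finally have "u = 0" by (simp add: fischer_definite)
    then show "c i = 0" using q_indep[of c i] i unfolding u_def by blast
  qed
  define Z where "Z = (\<Inter>j\<in>UNIV. kernel_on H (adjoint_on H ip (coord_mult j)))"
  have Z_iff: "g \<in> Z \<longleftrightarrow> g \<in> H \<and> (\<forall>j. \<forall>f\<in>I. ip (poly_on \<Omega> (pvar j * f)) g = 0)" for g
    unfolding Z_def by (rule completion_module_kernel_adjoints[OF assms(9)])
  have pvar_mem: "poly_on \<Omega> (pvar j * f) \<in> H" if "f \<in> I" for j f
    by (rule sub[OF ideal.subspace_scale[OF I that]])
  have Z: "cfun.subspace Z"
    unfolding cfun.subspace_def
    by (auto simp: Z_iff ip_zero_right ip_add_right ip_scale_right pvar_mem)
  have \<Gamma>_Z: "\<Gamma> (q i) \<in> Z" if i: "i \<in> ?A" for i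
  proof -
    have "ip (poly_on \<Omega> (pvar j * f)) (\<Gamma> (q i)) = 0" if "f \<in> I" for j f
    proof -
      have "(Poly_Mapping.single j 1 :: 'n \<Rightarrow>\<^sub>0 nat) \<noteq> 0" by (metis lookup_single_eq lookup_zero zero_neq_one)
      then show ?thesis using q_orth[OF i _ that] ip_\<Gamma>[OF ideal.subspace_scale[OF I that]] by (simp add: pvar_def)
    qed
    then show ?thesis unfolding Z_iff using \<Gamma>_mem by blast
  qed
  have "cfun.span ((\<lambda>i. \<Gamma> (q i)) ` ?A) = Z"
  proof
    show "cfun.span ((\<lambda>i. \<Gamma> (q i)) ` ?A) \<subseteq> Z"
      using \<Gamma>_Z by (intro cfun.span_minimal Z) blast
    show "Z \<subseteq> cfun.span ((\<lambda>i. \<Gamma> (q i)) ` ?A)"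
    proof
      fix g assume g: "g \<in> Z"
      then have gH: "g \<in> H" by (simp add: Z_iff)
      have I_sub: "cpoly.subspace I" by (rule ideal_imp_cpoly_subspace[OF I])
      let ?\<phi> = "\<lambda>f. ip (poly_on \<Omega> f) g"
      have \<phi>_add: "?\<phi> (e + f) = ?\<phi> e + ?\<phi> f" if "e \<in> I" "f \<in> I" for e f
        using that by (simp add: poly_on_add ip_add sub gH)
      have \<phi>_scale: "?\<phi> (poly_scale c f) = c * ?\<phi> f" if "f \<in> I" for c f
        using that by (simp add: poly_on_scale ip_scale sub gH)
      have "\<exists>u\<in>cpoly.span (q ` ?A). \<forall>b\<in>q ` ?A. ?\<phi> b = fischer b u"
        by (rule fischer_representation[OF I_sub _ _ \<phi>_add \<phi>_scale]) (use qI in auto)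
      then obtain u where u: "u \<in> cpoly.span (q ` ?A)" and u_q: "\<And>i. i \<in> ?A \<Longrightarrow> ?\<phi> (q i) = fischer (q i) u"
        by blast
      have u_orth: "fischer (pmonom \<alpha> * f) u = 0" if "\<alpha> \<noteq> 0" "f \<in> I" for \<alpha> f
      proof (rule cpoly.span_induct[OF u, of "\<lambda>u. fischer (pmonom \<alpha> * f) u = 0"])
        show "cpoly.subspace {u. fischer (pmonom \<alpha> * f) u = 0}"
          unfolding cpoly.subspace_def by (auto simp: fischer_add_right fischer_scale_right)
      qed (use q_orth that in auto)
      have \<phi>_orth: "?\<phi> (pmonom \<alpha> * f) = 0" if "\<alpha> \<noteq> 0" "f \<in> I" for \<alpha> f
      proof -
        obtain j \<beta> where "pmonom \<alpha> = pvar j * pmonom \<beta>" 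
          by (rule pmonom_factor_variable[OF \<open>\<alpha> \<noteq> 0\<close>])
        then show ?thesis
          using g ideal.subspace_scale[OF I that(2), of "pmonom \<beta>"] by (simp add: Z_iff mult.assoc)
      qed
      \<comment> \<open>Both functionals vanish on the multiples by nontrivial monomials and agree on the \<open>q i\<close>; together these span \<open>I\<close>.\<close>
      have \<phi>_u: "?\<phi> f = fischer f u" if "f \<in> I" for f
      proof -
        have "f \<in> {f \<in> I. ?\<phi> f = fischer f u}"
        proof (rule subsetD[OF cpoly.span_minimal subsetD[OF q_span that]])
          have "?\<phi> 0 = 0" using \<phi>_add[of 0 0] cpoly.subspace_0[OF I_sub] by simp
          then show "cpoly.subspace {f \<in> I. ?\<phi> f = fischer f u}"
            using I_sub unfolding cpoly.subspace_def
            by (auto simp: \<phi>_add \<phi>_scale fischer_add_left fischer_scale_left)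
          show "q ` ?A \<union> {pmonom \<alpha> * f |\<alpha> f. \<alpha> \<noteq> 0 \<and> f \<in> I} \<subseteq> {f \<in> I. ?\<phi> f = fischer f u}"
            using qI u_q \<phi>_orth u_orth ideal.subspace_scale[OF I] by auto
        qed
        then show ?thesis by blast
      qed
      have "g - \<Gamma> u = 0"
      proof (rule dense_orthogonal_imp_0[OF dense])
        show "ip h (g - \<Gamma> u) = 0" if "h \<in> poly_on \<Omega> ` I" for h
          using that \<phi>_u by (auto simp: ip_diff_right sub gH \<Gamma>_mem ip_\<Gamma>)
      qed (use sub gH \<Gamma>_mem in auto)
      moreover have "\<Gamma> u \<in> cfun.span ((\<lambda>i. \<Gamma> (q i)) ` ?A)"
      proof (rule cpoly.span_induct[OF u, of "\<lambda>u. \<Gamma> u \<in> cfun.span ((\<lambda>i. \<Gamma> (q i)) ` ?A)"])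
        show "cpoly.subspace {u. \<Gamma> u \<in> cfun.span ((\<lambda>i. \<Gamma> (q i)) ` ?A)}"
          unfolding cpoly.subspace_def \<Gamma>_def
          using cfun.span_zero cfun.span_add cfun.span_scale
          by (auto simp: poly_dbar_kernel_0 poly_dbar_kernel_add poly_dbar_kernel_scale)
      qed (auto intro: cfun.span_base)
      ultimately show "g \<in> cfun.span ((\<lambda>i. \<Gamma> (q i)) ` ?A)" by simp
    qed
  qed
  moreover note cfun.independent_family_image[of ?A "\<lambda>i. \<Gamma> (q i)", OF finite_atLeastAtMost \<Gamma>_indep]
  ultimately show ?thesis
    using q_gen unfolding \<Gamma>_def Z_def by (intro exI[of _ q] conjI)
qed

end
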